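(* Let $p,n_w,n_\zeta,s$ be positive integers. Let $Q_1,\dots,Q_s\in\mathbb{S}_+^{n_\zeta}$ satisfy $\sum_{i=1}^s Q_i\succ 0$ and let $$\mathscr{D}^N=\{\zeta\in\mathbb{R}^{n_\zeta} : \langle Q_i\zeta,\zeta\rangle\le 1,\ 1\le i\le s\}.$$ Let $\mathcal{M}:\mathbb{R}^{p}\to\mathbb{R}^{n_w\times(n_\zeta+1)}$ be an affine function, let $\mathcal{V}:\mathbb{R}^{p}\to\mathbb{S}^{n_\zeta+1}$ be matrix convex, and let $\beta\in\mathbb{R}^{n_w}$. For $\zeta\in\mathbb{R}^{n_\zeta}$ write $\zeta_e=\begin{bmatrix}1\\ \zeta\end{bmatrix}$. For $\gamma\in\mathbb{R}$ and $\chi\in\mathbb{R}^p$ consider the condition $$(\ast)\qquad \forall\zeta\in\mathscr{D}^N:\quad \gamma\ \ge\ \zeta_e^{\mathrm T}\,\mathcal{V}[\chi]\,\zeta_e+2\langle\beta,\mathcal{M}[\chi]\zeta_e\rangle .$$ For $\xi=(\gamma,\lambda,X,\chi)$ with $\lambda\in\mathbb{R}^s$ and $X\in\mathbb{S}^{n_\zeta+1}$ consider the system of constraints $$(\ast\ast)\qquad F[\xi]\succeq 0,\qquad \lambda\ge 0,\qquad X\succeq\mathcal{V}[\chi],$$ where $$F[\xi]=\begin{bmatrix}\gamma-\psi[X,\chi]-\sum_{i=1}^s[\lambda]_i & -\phi[X,\chi]^{\mathrm T}\\ -\phi[X,\chi] & \sum_{i=1}^s[\lambda]_iQ_i-\delta[X]\end{bmatrix},$$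 $$\delta[X]=\Pi_h^{\mathrm T}X\Pi_h,\quad \phi[X,\chi]^{\mathrm T}=\Pi_c^{\mathrm T}X\Pi_h+\beta^{\mathrm T}\mathcal{M}[\chi]\Pi_h,\quad \psi[X,\chi]=\Pi_c^{\mathrm T}X\Pi_c+2\beta^{\mathrm T}\mathcal{M}[\chi]\Pi_c .$$ (a) If $(\gamma,\chi)$ can be extended by some $\lambda\in\mathbb{R}^s$ and $X\in\mathbb{S}^{n_\zeta+1}$ to $\xi=(\gamma,\lambda,X,\chi)$ satisfying $(\ast\ast)$, then $(\ast)$ holds. Moreover the set of all $\xi$ satisfying $(\ast\ast)$ is convex. (b) If $(\gamma,\chi)$ cannot be extended by any $\lambda$ and $X$ so that $(\ast\ast)$ is satisfied, then the condition $$\forall\zeta\in\mathscr{D}^N:\quad \zeta_e^{\mathrm T}\,\mathcal{V}[\chi]\,\zeta_e+2\langle\beta,\mathcal{M}[\chi]\zeta_e\rangle\ \le\ \gamma^-$$ is violated for some $\zeta\in\mathscr{D}^N$, where $$\gamma^-=\begin{cases}\gamma, & s=1,\\[2pt] \dfrac1\Theta\big(\gamma-\Psi[\chi]\big)+\Psi[\chi]-\epsilon, & s>1,\end{cases}$$ with $\epsilon>0$ arbitrary, $\Theta=2\ln(s+1)+2\sqrt{\ln(s+1)}+1$, and $\Psi[\chi]=\Pi_c^{\mathrm T}\mathcal{V}[\chi]\Pi_c+2\beta^{\mathrm T}\mathcal{M}[\chi]\Pi_c$.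
   Context: $\mathbb{S}^n$ is the space of real symmetric $n\times n$ matrices, $\mathbb{S}^n_+$ the cone of positive semidefinite ones; $A\succeq B$ means $A-B\in\mathbb{S}^n_+$ and $A\succ B$ means that $A-B$ is positive definite. $[\lambda]_i$ is the $i$-th entry of $\lambda$, and $\lambda\ge0$ is understood entrywise. A map $\mathcal{V}:\mathbb{R}^p\to\mathbb{S}^{n}$ is matrix convex if for all $\mu\in[0,1]$ and $\chi,\hat\chi\in\mathbb{R}^p$, $\mathcal{V}[\mu\chi+(1-\mu)\hat\chi]\preceq\mu\mathcal{V}[\chi]+(1-\mu)\mathcal{V}[\hat\chi]$. $\Pi_h\in\mathbb{R}^{(n_\zeta+1)\times n_\zeta}$ and $\Pi_c\in\mathbb{R}^{(n_\zeta+1)\times 1}$ are given by $\Pi_h^{\mathrm T}=[\,0_{n_\zeta\times1}\ \ I_{n_\zeta}\,]$ and $\Pi_c^{\mathrm T}=[\,1\ \ 0_{1\times n_\zeta}\,]$. (In the source, $\mathbb{R}^p$ is the space of control-policy parameters; only its being a finite-dimensional real space matters.) *)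

theory Defs
  imports "HOL-Analysis.Analysis"
begin

text \<open>
  Conventions: \<open>real^'n^'m\<close> is the space of matrices with rows indexed by \<open>'m\<close> and columns
  indexed by \<open>'n\<close>.  An index set of size \<open>CARD('n) + 1\<close> is \<open>'n option\<close>: the index \<open>None\<close> is the
  distinguished first coordinate and \<open>Some j\<close> are the remaining ones.
\<close>

definition sym_mats :: "(real^'n^'n) set" where
  "sym_mats = {A. transpose A = A}"

definition psd :: "real^'n^'n \<Rightarrow> bool" where
  "psd A \<longleftrightarrow> A \<in> sym_mats \<and> (\<forall>x. 0 \<le> x \<bullet> (A *v x))"

definition posdef :: "real^'n^'n \<Rightarrow> bool" where
  "posdef A \<longleftrightarrow> A \<in> sym_mats \<and> (\<forall>x. x \<noteq> 0 \<longrightarrow> 0 < x \<bullet> (A *v x))"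

definition loewner_le :: "real^'n^'n \<Rightarrow> real^'n^'n \<Rightarrow> bool" (infix "\<preceq>" 50) where
  "A \<preceq> B \<longleftrightarrow> psd (B - A)"

definition matrix_convex :: "('a::real_vector \<Rightarrow> real^'n^'n) \<Rightarrow> bool" where
  "matrix_convex V \<longleftrightarrow>
     (\<forall>\<mu>\<in>{0..1}. \<forall>x y. V (\<mu> *\<^sub>R x + (1 - \<mu>) *\<^sub>R y) \<preceq> \<mu> *\<^sub>R V x + (1 - \<mu>) *\<^sub>R V y)"

definition affine_map :: "('a::real_vector \<Rightarrow> 'b::real_vector) \<Rightarrow> bool" where
  "affine_map f \<longleftrightarrow> (\<exists>L c. linear L \<and> (\<forall>x. f x = L x + c))"

definition ext_vec :: "real^'n \<Rightarrow> real^(('n::finite) option)" where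
  "ext_vec z = (\<chi> i. case i of None \<Rightarrow> 1 | Some j \<Rightarrow> z $ j)"

definition disturbance_set :: "('s \<Rightarrow> real^'n^'n) \<Rightarrow> (real^'n) set" where
  "disturbance_set Q = {z. \<forall>i. (Q i *v z) \<bullet> z \<le> 1}"

definition Pi_h :: "real^'n^(('n::finite) option)" where
  "Pi_h = (\<chi> i j. if i = Some j then 1 else 0)"

definition Pi_c :: "real^1^(('n::finite) option)" where
  "Pi_c = (\<chi> i j. if i = None then 1 else 0)"

definition delta :: "real^(('n::finite) option)^('n option) \<Rightarrow> real^'n^'n" where
  "delta X = transpose Pi_h ** X ** Pi_h"

text \<open>\<open>phiT\<close> is the row vector \<open>\<phi>[X,\<chi>]\<^sup>T\<close>.\<close>

definition phiT ::
  "real^'w \<Rightarrow> ('p \<Rightarrow> real^(('n::finite) option)^'w) \<Rightarrow> real^('n option)^('n option) \<Rightarrow> 'p \<Rightarrow> real^'n^1" where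
  "phiT \<beta> M X x = transpose Pi_c ** X ** Pi_h + rowvector \<beta> ** M x ** Pi_h"

text \<open>\<open>$ 1 $ 1\<close> reads a \<open>1 \<times> 1\<close> matrix as a scalar.\<close>

definition psi ::
  "real^'w \<Rightarrow> ('p \<Rightarrow> real^(('n::finite) option)^'w) \<Rightarrow> real^('n option)^('n option) \<Rightarrow> 'p \<Rightarrow> real" where
  "psi \<beta> M X x =
     (transpose Pi_c ** X ** Pi_c + 2 *\<^sub>R (rowvector \<beta> ** M x ** (Pi_c :: real^1^('n option))) :: real^1^1) $ 1 $ 1"

definition block_mat :: "real \<Rightarrow> real^'n^1 \<Rightarrow> real^1^'n \<Rightarrow> real^'n^'n \<Rightarrow> real^(('n::finite) option)^('n option)" where
  "block_mat a b c D = (\<chi> i j.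
     case i of
       None \<Rightarrow> (case j of None \<Rightarrow> a | Some l \<Rightarrow> b $ 1 $ l)
     | Some k \<Rightarrow> (case j of None \<Rightarrow> c $ k $ 1 | Some l \<Rightarrow> D $ k $ l))"

definition F_mat ::
  "('s::finite \<Rightarrow> real^'n^'n) \<Rightarrow> real^'w \<Rightarrow> ('p \<Rightarrow> real^(('n::finite) option)^'w) \<Rightarrow>
   real \<times> (real^'s) \<times> (real^('n option)^('n option)) \<times> 'p \<Rightarrow> real^('n option)^('n option)" where
  "F_mat Q \<beta> M = (\<lambda>(\<gamma>, l, X, x).
     block_mat (\<gamma> - psi \<beta> M X x - (\<Sum>i\<in>UNIV. l $ i)) (- phiT \<beta> M X x)
               (- transpose (phiT \<beta> M X x)) ((\<Sum>i\<in>UNIV. l $ i *\<^sub>R Q i) - delta X))"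

definition feasible_set ::
  "('s::finite \<Rightarrow> real^'n^'n) \<Rightarrow> real^'w \<Rightarrow> ('p \<Rightarrow> real^(('n::finite) option)^'w) \<Rightarrow>
   ('p \<Rightarrow> real^('n option)^('n option)) \<Rightarrow>
   (real \<times> (real^'s) \<times> (real^('n option)^('n option)) \<times> 'p) set" where
  "feasible_set Q \<beta> M V = {(\<gamma>, l, X, x).
     X \<in> sym_mats \<and> psd (F_mat Q \<beta> M (\<gamma>, l, X, x)) \<and> (\<forall>i. 0 \<le> l $ i) \<and> V x \<preceq> X}"

definition robust_obj ::
  "real^'w \<Rightarrow> ('p \<Rightarrow> real^(('n::finite) option)^'w) \<Rightarrow> ('p \<Rightarrow> real^('n option)^('n option)) \<Rightarrow>
   'p \<Rightarrow> real^'n \<Rightarrow> real" where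
  "robust_obj \<beta> M V x z =
     ext_vec z \<bullet> (V x *v ext_vec z) + 2 * (\<beta> \<bullet> (M x *v ext_vec z))"

definition Theta :: "nat \<Rightarrow> real" where
  "Theta s = 2 * ln (real s + 1) + 2 * sqrt (ln (real s + 1)) + 1"

text \<open>The argument \<open>\<Psi>\<close> stands for the value \<open>\<Psi>[\<chi>] = \<psi>[V[\<chi>], \<chi>]\<close>.\<close>

definition gamma_minus :: "nat \<Rightarrow> real \<Rightarrow> real \<Rightarrow> real \<Rightarrow> real" where
  "gamma_minus s \<epsilon> \<gamma> \<Psi> = (if s = 1 then \<gamma> else 1 / Theta s * (\<gamma> - \<Psi>) + \<Psi> - \<epsilon>)"

end

theory Submission
  imports Defs
begin

text \<open>
  Put \<open>R = V[\<chi>] + \<close> (the symmetric rank-two matrix carrying the linear term), so that the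
  objective is \<open>\<zeta>\<^sub>e\<^sup>T R \<zeta>\<^sub>e\<close>.  If \<open>X = V[\<chi>]\<close> admits no multiplier \<open>\<lambda>\<close>, separation
  gives a positive semidefinite \<open>Y\<close> with \<open>\<langle>R, Y\<rangle> > \<gamma> Y\<^sub>0\<^sub>0\<close> and \<open>\<langle>Q\<^sub>i, Y\<rangle> \<le> Y\<^sub>0\<^sub>0\<close>.  Two applications
  of the spectral theorem write \<open>Y = \<Sum> y y\<^sup>T\<close> with the \<open>y\<close> mutually orthogonal for the objective
  form, so that the objective takes the same value on all signed sums \<open>\<Sum> \<plusminus>y\<close>, and it remains to
  choose the signs so that the constraints are (almost) satisfied.

  For \<open>s = 1\<close> the signs are chosen greedily so that the constraint form does not fall below its
  mean.  For \<open>s > 1\<close> the \<open>s + 1\<close> constraints \<open>t\<^sup>2 \<le> 1\<close>, \<open>\<zeta>\<^sup>T Q\<^sub>i \<zeta> \<le> 1\<close> have mean at most 1; the signs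
  are chosen by the method of conditional expectations for the sum of their exponential moments,
  bounded through the Gaussian ones, which relaxes every constraint by at most the factor
  \<open>\<Theta>\<close>, removed by rescaling.
\<close>

section \<open>Simultaneous diagonalisation\<close>

text \<open>Induction on the dimension of \<open>S\<close>: a maximiser \<open>b\<close> of the
  quadratic form on the unit sphere of \<open>S\<close> is critical, so \<open>f\<close> maps
  vectors of \<open>S\<close> orthogonal to \<open>b\<close> to vectors orthogonal to
  \<open>b\<close>. Asking for vanishing off-diagonal entries instead of eigenvectors lets the
  induction pass to the complement of \<open>b\<close> in \<open>S\<close> without showing that
  \<open>f\<close> preserves it.\<close>

lemma self_adjoint_spectral:
  fixes f :: "'a::euclidean_space \<Rightarrow> 'a"
  assumes lin: "linear f" and sym: "\<And>x y. f x \<bullet> y = x \<bullet> f y" and S: "subspace S"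
  obtains B where "finite B" "B \<subseteq> S" "span B = S" "pairwise orthogonal B"
    "\<And>b. b \<in> B \<Longrightarrow> norm b = 1" "\<And>b c. b \<in> B \<Longrightarrow> c \<in> B \<Longrightarrow> b \<noteq> c \<Longrightarrow> b \<bullet> f c = 0"
proof -
  have "\<exists>B. finite B \<and> B \<subseteq> S \<and> span B = S \<and> pairwise orthogonal B \<and> (\<forall>b\<in>B. norm b = 1) \<and>
      (\<forall>b\<in>B. \<forall>c\<in>B. b \<noteq> c \<longrightarrow> b \<bullet> f c = 0)"
    using S
  proof (induction "dim S" arbitrary: S rule: less_induct)
    case less
    show ?case
    proof (cases "S \<subseteq> {0}")
      case True
      then have "S = {0}" using subspace_0[OF less.prems] by auto
      then show ?thesis by (intro exI[of _ "{}"]) auto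
    next
      case False
      then obtain v where v: "v \<in> S" "v \<noteq> 0" by auto
      define K where "K = S \<inter> sphere 0 1"
      have "compact K" unfolding K_def
        by (simp add: closed_Int_compact closed_subspace less.prems)
      moreover have "v /\<^sub>R norm v \<in> K"
        using v less.prems by (simp add: K_def subspace_scale)
      moreover have "continuous_on K (\<lambda>x. x \<bullet> f x)"
        using lin by (intro continuous_intros linear_continuous_on linear_conv_bounded_linear[THEN iffD1])
      ultimately obtain b where bK: "b \<in> K" and max: "\<And>x. x \<in> K \<Longrightarrow> x \<bullet> f x \<le> b \<bullet> f b"
        using continuous_attains_sup[of K "\<lambda>x. x \<bullet> f x"] by blast
      have b: "b \<in> S" "norm b = 1" using bK by (auto simp: K_def)
      have bb: "b \<bullet> b = 1" using b by (simp add: dot_square_norm)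
      define m where "m = b \<bullet> f b"
      have bound: "x \<bullet> f x \<le> m * (x \<bullet> x)" if "x \<in> S" for x
      proof (cases "x = 0")
        case True then show ?thesis by simp
      next
        case False
        have "x /\<^sub>R norm x \<in> K" using that False less.prems by (simp add: K_def subspace_scale)
        from max[OF this] have "x \<bullet> f x / (norm x)\<^sup>2 \<le> m"
          using lin by (simp add: m_def linear_scale power2_eq_square divide_inverse mult_ac)
        then show ?thesis using False by (simp add: divide_le_eq dot_square_norm)
      qed
      \<comment> \<open>First-order condition at the maximiser: \<open>bound\<close> at
        \<open>b + t u\<close> yields 2 t \<alpha> <= t^2 k, and t = \<alpha> / k turns this into 2
        \<alpha>^2 / k <= \<alpha>^2 / k.\<close>
      have crit: "b \<bullet> f u = 0" if u: "u \<in> S" "b \<bullet> u = 0" for u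
      proof (rule ccontr)
        assume ne: "b \<bullet> f u \<noteq> 0"
        define \<alpha> where "\<alpha> = b \<bullet> f u"
        define k where "k = \<bar>m * (u \<bullet> u) - u \<bullet> f u\<bar> + 1"
        define t where "t = \<alpha> / k"
        have k: "k > 0" by (simp add: k_def)
        have "b + t *\<^sub>R u \<in> S" using b u less.prems by (simp add: subspace_add subspace_scale)
        from bound[OF this] have "2 * t * \<alpha> \<le> t\<^sup>2 * (m * (u \<bullet> u) - u \<bullet> f u)"
          using lin sym[of u b] sym[of b u] u bb
          by (simp add: linear_add linear_scale inner_add inner_commute \<alpha>_def m_def[symmetric]
              power2_eq_square algebra_simps)
        also have "\<dots> \<le> t\<^sup>2 * k" by (intro mult_left_mono) (auto simp: k_def)
        also have "\<dots> = t * \<alpha>" using k by (simp add: t_def power2_eq_square)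
        finally have "t * \<alpha> \<le> 0" by (simp add: mult.commute)
        moreover have "t * \<alpha> = \<alpha>\<^sup>2 / k" by (simp add: t_def power2_eq_square)
        moreover have "\<alpha>\<^sup>2 / k > 0" using ne k by (simp add: \<alpha>_def)
        ultimately show False by simp
      qed
      define T where "T = {x \<in> S. b \<bullet> x = 0}"
      have T: "subspace T"
        using less.prems by (auto simp: T_def subspace_def inner_add)
      have "T \<subseteq> S" "b \<notin> T" using bb by (auto simp: T_def)
      then have "dim T < dim S" using T less.prems b(1)
        by (metis dim_psubset psubsetI span_eq_iff)
      from less.hyps[OF this T] obtain B where B: "finite B" "B \<subseteq> T" "span B = T"
        "pairwise orthogonal B" "\<forall>b\<in>B. norm b = 1" "\<forall>b\<in>B. \<forall>c\<in>B. b \<noteq> c \<longrightarrow> b \<bullet> f c = 0" by blast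
      have "span (insert b B) = S"
      proof
        show "span (insert b B) \<subseteq> S"
          using B(2) b(1) less.prems \<open>T \<subseteq> S\<close> by (intro span_minimal) auto
        show "S \<subseteq> span (insert b B)"
        proof
          fix x assume x: "x \<in> S"
          have "x - (b \<bullet> x) *\<^sub>R b \<in> T"
            using x b(1) bb less.prems by (simp add: T_def subspace_diff subspace_scale inner_diff)
          then show "x \<in> span (insert b B)"
            using B(3) by (metis span_breakdown_eq)
        qed
      qed
      moreover have "pairwise orthogonal (insert b B)"
        using B by (auto simp: pairwise_insert T_def orthogonal_def inner_commute)
      moreover have "\<forall>a\<in>insert b B. \<forall>c\<in>insert b B. a \<noteq> c \<longrightarrow> a \<bullet> f c = 0"
      proof -
        have "b \<bullet> f c = 0" "c \<bullet> f b = 0" if "c \<in> B" for c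
        proof -
          have "c \<in> S" "b \<bullet> c = 0" using that B(2) by (auto simp: T_def)
          then show "b \<bullet> f c = 0" by (rule crit)
          then show "c \<bullet> f b = 0" by (metis sym inner_commute)
        qed
        then show ?thesis using B(6) by auto
      qed
      ultimately show ?thesis using B b \<open>T \<subseteq> S\<close> by (intro exI[of _ "insert b B"]) auto
    qed
  qed
  then show thesis using that by metis
qed

text \<open>Expand the left factor \<open>c\<close> in \<open>B\<close>, swap the sums, and
  recognise the inner sum over \<open>C\<close> as the expansion of \<open>b\<close>.\<close>

lemma trace_orthonormal_basis:
  fixes f :: "'a::euclidean_space \<Rightarrow> 'a"
  assumes lin: "linear f"
    and B: "finite B" "pairwise orthogonal B" "\<And>b. b \<in> B \<Longrightarrow> norm b = 1" "span B = UNIV"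
    and C: "finite C" "pairwise orthogonal C" "\<And>c. c \<in> C \<Longrightarrow> norm c = 1" "span C = UNIV"
  shows "(\<Sum>c\<in>C. c \<bullet> f c) = (\<Sum>b\<in>B. b \<bullet> f b)"
proof -
  have expB: "(\<Sum>b\<in>B. (x \<bullet> b) *\<^sub>R b) = x" for x
    using B by (intro orthonormal_basis_expand) auto
  have expC: "(\<Sum>c\<in>C. (x \<bullet> c) *\<^sub>R c) = x" for x
    using C by (intro orthonormal_basis_expand) auto
  have "(\<Sum>c\<in>C. c \<bullet> f c) = (\<Sum>c\<in>C. \<Sum>b\<in>B. (c \<bullet> b) * (b \<bullet> f c))"
    by (intro sum.cong refl, subst expB[symmetric]) (simp add: inner_sum_left)
  also have "\<dots> = (\<Sum>b\<in>B. b \<bullet> f (\<Sum>c\<in>C. (b \<bullet> c) *\<^sub>R c))"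
    by (subst sum.swap) (simp add: linear_sum[OF lin] linear_scale[OF lin] inner_sum_right inner_commute)
  finally show ?thesis by (simp add: expC)
qed

lemma sym_mats_inner: "A \<in> sym_mats \<Longrightarrow> (A *v x) \<bullet> y = x \<bullet> (A *v y)"
  by (simp add: sym_mats_def dot_lmul_matrix[symmetric] transpose_matrix_vector[symmetric])

text \<open>The entrywise product is the trace of \<open>G\<close> times the transpose of
  \<open>X\<close>; symmetry removes the transpose. As a trace it can be computed in any orthonormal
  basis.\<close>

lemma inner_eq_trace:
  fixes G X :: "real^'k^'k"
  assumes "X \<in> sym_mats"
  shows "G \<bullet> X = (\<Sum>b\<in>Basis. b \<bullet> (G *v (X *v b)))"
proof -
  have X: "X $ i $ j = X $ j $ i" for i j
    using assms by (auto simp: sym_mats_def transpose_def vec_eq_iff)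
  have "(\<Sum>b\<in>Basis. b \<bullet> (G *v (X *v b))) = (\<Sum>i\<in>UNIV. axis i 1 \<bullet> (G *v (X *v axis i 1)))"
    by (simp add: Basis_vec_def sum.UNION_disjoint axis_eq_axis UNION_singleton_eq_range
       sum.reindex inj_def)
  also have "\<dots> = (\<Sum>i\<in>UNIV. \<Sum>j\<in>UNIV. G $ i $ j * X $ j $ i)"
    by (simp add: inner_axis' matrix_vector_mult_basis) (simp add: matrix_vector_mult_def column_def)
  finally show ?thesis by (simp add: inner_vec_def X)
qed

text \<open>Let \<open>W\<close> be the square root of \<open>X\<close> and let \<open>C\<close> be
  an orthonormal basis diagonalising \<open>W A W\<close>. The vectors \<open>W c\<close> are then
  orthogonal for \<open>A\<close>, and their outer products sum to W W = X, which is expressed by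
  testing against every \<open>G\<close>.\<close>

lemma psd_orthogonal_decomposition:
  fixes A X :: "real^'k^'k"
  assumes X: "psd X" and A: "A \<in> sym_mats"
  obtains C and y :: "real^'k \<Rightarrow> real^'k" where "finite C"
    "\<And>c d. c \<in> C \<Longrightarrow> d \<in> C \<Longrightarrow> c \<noteq> d \<Longrightarrow> y c \<bullet> (A *v y d) = 0"
    "\<And>G. G \<bullet> X = (\<Sum>c\<in>C. y c \<bullet> (G *v y c))"
proof -
  have Xs: "X \<in> sym_mats" using X by (simp add: psd_def)
  note [simp] = matrix_vector_mul_linear
  obtain B where B: "finite B" "span B = UNIV" "pairwise orthogonal B"
    "\<And>b. b \<in> B \<Longrightarrow> norm b = 1"
    and Bd: "\<And>b c. b \<in> B \<Longrightarrow> c \<in> B \<Longrightarrow> b \<noteq> c \<Longrightarrow> b \<bullet> (X *v c) = 0"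
    using self_adjoint_spectral[of "(*v) X" UNIV] sym_mats_inner[OF Xs] by auto
  define \<mu> where "\<mu> b = b \<bullet> (X *v b)" for b
  have \<mu>: "\<mu> b \<ge> 0" for b using X by (simp add: \<mu>_def psd_def)
  have expB: "(\<Sum>b\<in>B. (x \<bullet> b) *\<^sub>R b) = x" for x
    using B by (intro orthonormal_basis_expand) auto
  have Xb: "X *v b = \<mu> b *\<^sub>R b" if b: "b \<in> B" for b
  proof -
    have "X *v b = (\<Sum>c\<in>B. ((X *v b) \<bullet> c) *\<^sub>R c)" by (simp add: expB)
    also have "\<dots> = (\<Sum>c\<in>B. if c = b then \<mu> b *\<^sub>R b else 0)"
      by (intro sum.cong refl) (use b Bd in \<open>auto simp: \<mu>_def inner_commute\<close>)
    finally show ?thesis using b B(1) by simp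
  qed
  define W where "W v = (\<Sum>b\<in>B. (sqrt (\<mu> b) * (b \<bullet> v)) *\<^sub>R b)" for v
  have Wlin: "linear W"
    by (rule linearI) (simp_all add: W_def inner_add algebra_simps sum.distrib scaleR_sum_right)
  have Wsym: "W v \<bullet> w = v \<bullet> W w" for v w
    by (simp add: W_def inner_sum_left inner_sum_right inner_commute mult_ac)
  have Wb: "W b = sqrt (\<mu> b) *\<^sub>R b" if b: "b \<in> B" for b
  proof -
    have "W b = (\<Sum>c\<in>B. if c = b then sqrt (\<mu> b) *\<^sub>R b else 0)"
      unfolding W_def
      by (intro sum.cong refl) (use b B in \<open>auto simp: pairwise_def orthogonal_def dot_square_norm\<close>)
    then show ?thesis using b B(1) by simp
  qed
  have lin: "linear (\<lambda>v. W (G *v W v))" for G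
    using linear_compose[OF linear_compose[OF Wlin matrix_vector_mul_linear[of G]] Wlin]
    by (simp add: o_def)
  have "W (A *v W x) \<bullet> z = x \<bullet> W (A *v W z)" for x z
    by (metis Wsym sym_mats_inner[OF A])
  then obtain C where C: "finite C" "span C = UNIV" "pairwise orthogonal C"
    "\<And>b. b \<in> C \<Longrightarrow> norm b = 1"
    and Cd: "\<And>b c. b \<in> C \<Longrightarrow> c \<in> C \<Longrightarrow> b \<noteq> c \<Longrightarrow> b \<bullet> W (A *v W c) = 0"
    using self_adjoint_spectral[of "\<lambda>v. W (A *v W v)" UNIV] lin[of A] by auto
  show thesis
  proof (rule that[of C W])
    show "W c \<bullet> (A *v W d) = 0" if "c \<in> C" "d \<in> C" "c \<noteq> d" for c d
      using Cd[OF that] by (simp add: Wsym)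
    show "G \<bullet> X = (\<Sum>c\<in>C. W c \<bullet> (G *v W c))" for G
    proof -
      have "G \<bullet> X = (\<Sum>b\<in>Basis. b \<bullet> (G *v (X *v b)))" by (rule inner_eq_trace[OF Xs])
      also have "\<dots> = (\<Sum>b\<in>B. b \<bullet> (G *v (X *v b)))"
        using B linear_compose[OF matrix_vector_mul_linear[of X] matrix_vector_mul_linear[of G]]
        by (intro trace_orthonormal_basis) (auto simp: pairwise_def orthogonal_def inner_Basis o_def)
      \<comment> \<open>Elements of \<open>B\<close> are eigenvectors of \<open>X\<close> and of
        \<open>W\<close>, with eigenvalues \<mu> b and its square root, so \<mu> b splits evenly
        between the two sides of \<open>G\<close>.\<close>
      also have "\<dots> = (\<Sum>b\<in>B. b \<bullet> W (G *v W b))"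
        using \<mu> by (intro sum.cong refl)
          (simp add: Xb Wb matrix_vector_mult_scaleR linear_scale[OF Wlin] flip: Wsym)
      also have "\<dots> = (\<Sum>c\<in>C. c \<bullet> W (G *v W c))"
        using B C lin[of G] by (intro trace_orthonormal_basis) auto
      finally show ?thesis by (simp add: Wsym)
    qed
  qed (rule C)
qed

section \<open>Choosing signs\<close>

text \<open>On the nonnegative axis cosh t exp(-t^2/2) decreases from 1, because sinh t <= t cosh t;
  the latter follows by differentiating once more. Evenness covers negative
  \<open>x\<close>.\<close>

lemma cosh_le_exp_square: "cosh x \<le> exp (x\<^sup>2 / 2)" for x :: real
proof -
  have sinh_le: "sinh t \<le> t * cosh t" if "t \<ge> 0" for t :: real
  proof -
    have "(0 * cosh 0 - sinh 0 :: real) \<le> t * cosh t - sinh t"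
    proof (rule DERIV_nonneg_imp_nondecreasing[OF that])
      fix s :: real assume "0 \<le> s"
      then show "\<exists>d. ((\<lambda>t. t * cosh t - sinh t) has_real_derivative d) (at s) \<and> 0 \<le> d"
        by (intro exI[of _ "s * sinh s"]) (auto intro!: derivative_eq_intros)
    qed
    then show ?thesis by simp
  qed
  have *: "cosh t \<le> exp (t\<^sup>2 / 2)" if "t \<ge> 0" for t :: real
  proof -
    have "cosh t * exp (- t\<^sup>2 / 2) \<le> cosh 0 * exp (- 0\<^sup>2 / 2)"
    proof (rule DERIV_nonpos_imp_nonincreasing[OF that])
      fix s :: real assume s: "0 \<le> s"
      have "((\<lambda>t. cosh t * exp (- t\<^sup>2 / 2)) has_real_derivative
          (sinh s - s * cosh s) * exp (- s\<^sup>2 / 2)) (at s)"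
        by (auto intro!: derivative_eq_intros simp: algebra_simps)
      moreover have "(sinh s - s * cosh s) * exp (- s\<^sup>2 / 2) \<le> 0"
        using sinh_le[OF s] by (simp add: mult_nonpos_nonneg)
      ultimately show "\<exists>d. ((\<lambda>t. cosh t * exp (- t\<^sup>2 / 2)) has_real_derivative d) (at s) \<and> d \<le> 0"
        by blast
    qed
    then show ?thesis by (simp add: exp_minus divide_simps)
  qed
  have "cosh x = cosh \<bar>x\<bar>" by (simp add: abs_if)
  also have "\<dots> \<le> exp (\<bar>x\<bar>\<^sup>2 / 2)" by (rule *) simp
  finally show ?thesis by simp
qed

text \<open>
  For \<open>2 c \<tau> < 1\<close> this is the expectation of \<open>exp (c (u + sqrt \<tau> g)\<^sup>2)\<close> for a standard Gaussian \<open>g\<close>.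
  The step inequality says that replacing an increment of variance \<open>v\<^sup>2\<close> by \<open>\<plusminus>v\<close> with equal
  probability does not increase it.
\<close>

definition gauss_mgf :: "real \<Rightarrow> real \<Rightarrow> real \<Rightarrow> real" where
  "gauss_mgf c \<tau> u = exp (c * u\<^sup>2 / (1 - 2 * c * \<tau>)) / sqrt (1 - 2 * c * \<tau>)"

lemma gauss_mgf_step:
  assumes c: "0 \<le> c" and pos: "2 * c * (\<tau> + v\<^sup>2) < 1"
  shows "gauss_mgf c \<tau> (u + v) + gauss_mgf c \<tau> (u - v) \<le> 2 * gauss_mgf c (\<tau> + v\<^sup>2) u"
proof -
  define d where "d = 1 - 2 * c * \<tau>"
  \<comment> \<open>\<open>w\<close> is the share of the old denominator \<open>d\<close> consumed
    by the new variance: the new denominator is d (1 - w).\<close>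
  define w where "w = 2 * c * v\<^sup>2 / d"
  have cv: "0 \<le> 2 * c * v\<^sup>2" using c by simp
  have d: "2 * c * v\<^sup>2 < d" "d > 0"
    using pos cv unfolding d_def by (simp_all add: algebra_simps)
  have w: "0 \<le> w" "w < 1" using cv d by (simp_all add: w_def divide_less_eq)
  have d': "1 - 2 * c * (\<tau> + v\<^sup>2) = d * (1 - w)"
    using d(2) by (simp add: w_def d_def field_simps)
  have "exp (c * (u + v)\<^sup>2 / d) + exp (c * (u - v)\<^sup>2 / d)
      = exp (c * (u\<^sup>2 + v\<^sup>2) / d) * (exp (2 * c * u * v / d) + exp (- (2 * c * u * v / d)))"
    using d(2) by (simp add: distrib_left mult_exp_exp power2_eq_square field_simps)
  also have "\<dots> = 2 * exp (c * (u\<^sup>2 + v\<^sup>2) / d) * cosh (2 * c * u * v / d)"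
    by (simp add: cosh_def)
  also have "\<dots> \<le> 2 * exp (c * (u\<^sup>2 + v\<^sup>2) / d) * exp ((2 * c * u * v / d)\<^sup>2 / 2)"
    by (intro mult_left_mono cosh_le_exp_square) auto
  also have "\<dots> = 2 * (exp (c * u\<^sup>2 / d * (1 + w)) * exp (w / 2))"
    using d(2) by (simp add: mult_exp_exp w_def power2_eq_square field_simps)
  \<comment> \<open>The two factors are compared separately: 1 + w <= 1 / (1 - w) in the exponent,
    and 1 - w <= exp(-w) for the normalising root.\<close>
  also have "\<dots> \<le> 2 * (exp (c * u\<^sup>2 / d / (1 - w)) * (1 / sqrt (1 - w)))"
  proof -
    have "1 + w \<le> 1 / (1 - w)" using w by (simp add: divide_simps algebra_simps)
    then have "c * u\<^sup>2 / d * (1 + w) \<le> c * u\<^sup>2 / d * (1 / (1 - w))"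
      using c d by (intro mult_left_mono) auto
    moreover have "exp (w / 2) \<le> 1 / sqrt (1 - w)"
    proof -
      have "sqrt (1 - w) \<le> sqrt (exp (- w))"
        using exp_ge_add_one_self[of "- w"] by simp
      also have "sqrt (exp (- w)) = exp (- w / 2)"
        by (rule real_sqrt_unique) (simp_all add: power2_eq_square mult_exp_exp)
      finally show ?thesis using w by (simp add: exp_minus field_simps)
    qed
    ultimately show ?thesis using w by (intro mult_left_mono mult_mono) auto
  qed
  finally have "(exp (c * (u + v)\<^sup>2 / d) + exp (c * (u - v)\<^sup>2 / d)) / sqrt d
      \<le> 2 * (exp (c * u\<^sup>2 / d / (1 - w)) * (1 / sqrt (1 - w))) / sqrt d"
    using d by (intro divide_right_mono) auto
  then show ?thesis
    unfolding gauss_mgf_def d' d_def[symmetric]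
    by (simp add: add_divide_distrib real_sqrt_mult mult.commute)
qed

text \<open>Method of conditional expectations. \<tau> j is the variance of the terms still treated
  as Gaussian; it is arbitrary in the induction because the signs on \<open>C\<close> are fixed
  first, with the term of \<open>k\<close> counted in \<tau>', and only then is the sign of
  \<open>k\<close> chosen.\<close>

lemma signs_gauss_mgf:
  fixes a :: "'j \<Rightarrow> 'c \<Rightarrow> real"
  assumes c: "0 \<le> c" and C: "finite C" and q: "\<And>j. j \<in> J \<Longrightarrow> 0 \<le> q j"
    and "\<And>j. j \<in> J \<Longrightarrow> 2 * c * (\<tau> j + (\<Sum>k\<in>C. (a j k)\<^sup>2)) < 1"
  shows "\<exists>\<sigma>. (\<forall>k. \<sigma> k \<in> {-1, 1}) \<and>
     (\<Sum>j\<in>J. q j * gauss_mgf c (\<tau> j) (\<Sum>k\<in>C. \<sigma> k * a j k))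
       \<le> (\<Sum>j\<in>J. q j * gauss_mgf c (\<tau> j + (\<Sum>k\<in>C. (a j k)\<^sup>2)) 0)"
  using C assms(4)
proof (induction C arbitrary: \<tau> rule: finite_induct)
  case empty
  show ?case by (intro exI[of _ "\<lambda>_. 1"]) simp
next
  case (insert k C)
  define \<tau>' where "\<tau>' j = \<tau> j + (a j k)\<^sup>2" for j
  have tot: "\<tau> j + (\<Sum>k\<in>insert k C. (a j k)\<^sup>2) = \<tau>' j + (\<Sum>k\<in>C. (a j k)\<^sup>2)" for j
    using insert.hyps by (simp add: \<tau>'_def)
  have bd: "2 * c * (\<tau>' j + (\<Sum>k\<in>C. (a j k)\<^sup>2)) < 1" if "j \<in> J" for j
    using insert.prems[OF that] by (simp only: tot)
  from insert.IH[of \<tau>', OF bd] obtain \<sigma> where \<sigma>: "\<And>k. \<sigma> k \<in> {-1, 1}"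
    and le: "(\<Sum>j\<in>J. q j * gauss_mgf c (\<tau>' j) (\<Sum>k\<in>C. \<sigma> k * a j k))
       \<le> (\<Sum>j\<in>J. q j * gauss_mgf c (\<tau>' j + (\<Sum>k\<in>C. (a j k)\<^sup>2)) 0)"
    by auto
  define P where "P s = (\<Sum>j\<in>J. q j * gauss_mgf c (\<tau> j) ((\<Sum>k\<in>C. \<sigma> k * a j k) + s * a j k))" for s
  have "P 1 + P (-1) \<le> 2 * (\<Sum>j\<in>J. q j * gauss_mgf c (\<tau>' j) (\<Sum>k\<in>C. \<sigma> k * a j k))"
    unfolding P_def sum.distrib[symmetric] sum_distrib_left
  proof (rule sum_mono)
    fix j assume j: "j \<in> J"
    have "2 * c * \<tau>' j \<le> 2 * c * (\<tau>' j + (\<Sum>k\<in>C. (a j k)\<^sup>2))"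
      using c by (intro mult_left_mono) (auto intro: sum_nonneg)
    then have "2 * c * (\<tau> j + (a j k)\<^sup>2) < 1" using bd[OF j] by (simp add: \<tau>'_def)
    from mult_left_mono[OF gauss_mgf_step[OF c this] q[OF j]]
    show "q j * gauss_mgf c (\<tau> j) ((\<Sum>k\<in>C. \<sigma> k * a j k) + 1 * a j k) +
         q j * gauss_mgf c (\<tau> j) ((\<Sum>k\<in>C. \<sigma> k * a j k) + - 1 * a j k)
         \<le> 2 * (q j * gauss_mgf c (\<tau>' j) (\<Sum>k\<in>C. \<sigma> k * a j k))"
      by (simp add: \<tau>'_def distrib_left mult.left_commute)
  qed
  \<comment> \<open>The smaller of the two values is at most their average.\<close>
  then obtain s where s: "s \<in> {-1, 1::real}"
    "P s \<le> (\<Sum>j\<in>J. q j * gauss_mgf c (\<tau>' j) (\<Sum>k\<in>C. \<sigma> k * a j k))"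
    by (cases "P 1 \<le> P (-1)") (force intro: that[of 1], force intro: that[of "-1"])
  have "(\<Sum>i\<in>insert k C. (\<sigma>(k := s)) i * a j i) = (\<Sum>k\<in>C. \<sigma> k * a j k) + s * a j k" for j
    using insert.hyps by (auto intro!: sum.cong)
  then show ?case
    using s \<sigma> le by (intro exI[of _ "\<sigma>(k := s)"]) (auto simp: tot P_def simp del: sum.insert)
qed

section \<open>Rank-one matrices and exponential bounds for positive semidefinite forms\<close>

definition outer :: "real^'k \<Rightarrow> real^'k^'k" where
  "outer v = (\<chi> i j. v $ i * v $ j)"

lemma inner_outer: "A \<bullet> outer v = v \<bullet> (A *v v)"
  by (simp add: outer_def inner_vec_def matrix_vector_mult_def sum_distrib_left mult_ac)

lemma outer_quadratic: "y \<bullet> (outer v *v y) = (v \<bullet> y)\<^sup>2"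
  by (simp add: outer_def inner_vec_def matrix_vector_mult_def sum_distrib_left sum_distrib_right
      power2_eq_square mult_ac sum_product)

lemma psd_outer: "psd (outer v)"
  by (simp add: psd_def sym_mats_def outer_quadratic) (simp add: outer_def transpose_def vec_eq_iff mult.commute)

text \<open>Obtained by testing the decomposition of \<open>A\<close> against
  \<open>outer v\<close>.\<close>

lemma psd_sum_squares:
  fixes A :: "real^'k^'k"
  assumes "psd A"
  shows "\<exists>K (w :: real^'k \<Rightarrow> real^'k). finite K \<and> (\<forall>v. v \<bullet> (A *v v) = (\<Sum>k\<in>K. (w k \<bullet> v)\<^sup>2))"
proof -
  obtain C and y :: "real^'k \<Rightarrow> real^'k" where C: "finite C"
    "\<And>G. G \<bullet> A = (\<Sum>c\<in>C. y c \<bullet> (G *v y c))"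
    using psd_orthogonal_decomposition[OF assms, of A] assms by (metis psd_def)
  have "v \<bullet> (A *v v) = (\<Sum>k\<in>C. (y k \<bullet> v)\<^sup>2)" for v
    using C(2)[of "outer v"] inner_outer[of A v]
    by (simp add: outer_quadratic inner_commute[of v] inner_commute[of _ A])
  then show ?thesis using C(1) by blast
qed

text \<open>Dividing the exponent by the total weight, which is at most 1, only enlarges it and
  makes it a convex combination; then Jensen applies.\<close>

lemma exp_sum_squares_le:
  assumes K: "finite K" and c: "0 \<le> c"
    and \<tau>: "\<And>k. k \<in> K \<Longrightarrow> 0 \<le> \<tau> k" "0 < (\<Sum>k\<in>K. \<tau> k)" "(\<Sum>k\<in>K. \<tau> k) \<le> (1::real)"
  shows "exp (c * (\<Sum>k\<in>K. \<tau> k * (s k)\<^sup>2))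
    \<le> (\<Sum>k\<in>K. \<tau> k / (\<Sum>k\<in>K. \<tau> k) * exp (c * (s k)\<^sup>2))"
proof -
  define T where "T = (\<Sum>k\<in>K. \<tau> k)"
  have T: "0 < T" "T \<le> 1" using \<tau> by (simp_all add: T_def)
  have nn: "0 \<le> (\<Sum>k\<in>K. \<tau> k * (s k)\<^sup>2)" by (intro sum_nonneg) (simp add: \<tau>)
  have "c * (\<Sum>k\<in>K. \<tau> k * (s k)\<^sup>2) \<le> c * ((\<Sum>k\<in>K. \<tau> k * (s k)\<^sup>2) / T)"
    using nn T c mult_left_mono[OF T(2) nn] by (intro mult_left_mono) (auto simp: le_divide_eq)
  also have "\<dots> = (\<Sum>k\<in>K. (\<tau> k / T) *\<^sub>R (c * (s k)\<^sup>2))"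
    by (simp add: sum_distrib_left sum_divide_distrib mult_ac)
  finally have "exp (c * (\<Sum>k\<in>K. \<tau> k * (s k)\<^sup>2)) \<le> exp (\<Sum>k\<in>K. (\<tau> k / T) *\<^sub>R (c * (s k)\<^sup>2))"
    by simp
  also have "\<dots> \<le> (\<Sum>k\<in>K. \<tau> k / T * exp (c * (s k)\<^sup>2))"
  proof (rule convex_on_sum[OF K _ exp_convex])
    show "K \<noteq> {}" using T(1) by (auto simp: T_def)
    show "(\<Sum>k\<in>K. \<tau> k / T) = 1" using T(1) by (simp add: T_def flip: sum_divide_distrib)
    show "0 \<le> \<tau> k / T" if "k \<in> K" for k using \<tau>(1)[OF that] T(1) by simp
  qed simp
  finally show ?thesis by (simp add: T_def)
qed

text \<open>Each form is a sum of squares of linear forms, and \<tau> i k is the mean square of such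
  a linear form over random signs. Rescaled to variance 1 and weighted by \<tau> i k / T i, the
  linear forms of all \<open>i\<close> enter one potential, whose Gaussian value is at most the
  right-hand side. Jensen bounds the exponential for a single \<open>i\<close> by its part of the
  potential.\<close>

lemma signs_psd_exp_bound:
  fixes A :: "'i \<Rightarrow> real^'k^'k" and y :: "'c \<Rightarrow> real^'k"
  assumes I: "finite I" "I \<noteq> {}" and C: "finite C" and A: "\<And>i. i \<in> I \<Longrightarrow> psd (A i)"
    and le1: "\<And>i. i \<in> I \<Longrightarrow> (\<Sum>c\<in>C. y c \<bullet> (A i *v y c)) \<le> 1"
    and c: "0 < c" "2 * c < 1"
  obtains \<sigma> :: "'c \<Rightarrow> real" where "\<And>k. \<sigma> k \<in> {-1, 1}"
    "\<And>i z. i \<in> I \<Longrightarrow> z = (\<Sum>k\<in>C. \<sigma> k *\<^sub>R y k) \<Longrightarrow>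
       exp (c * (z \<bullet> (A i *v z))) \<le> card I / sqrt (1 - 2 * c)"
proof -
  have "\<forall>i\<in>I. \<exists>K (w :: real^'k \<Rightarrow> real^'k). finite K \<and> (\<forall>v. v \<bullet> (A i *v v) = (\<Sum>k\<in>K. (w k \<bullet> v)\<^sup>2))"
    using psd_sum_squares[OF A] by blast
  then obtain K and w :: "'i \<Rightarrow> real^'k \<Rightarrow> real^'k" where K: "\<And>i. i \<in> I \<Longrightarrow> finite (K i)"
    and w: "\<And>i v. i \<in> I \<Longrightarrow> v \<bullet> (A i *v v) = (\<Sum>k\<in>K i. (w i k \<bullet> v)\<^sup>2)" by metis
  define \<tau> where "\<tau> i k = (\<Sum>l\<in>C. (w i k \<bullet> y l)\<^sup>2)" for i k
  define T where "T i = (\<Sum>k\<in>K i. \<tau> i k)" for i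
  have \<tau>0: "0 \<le> \<tau> i k" for i k by (simp add: \<tau>_def sum_nonneg)
  have T0: "0 \<le> T i" for i by (simp add: T_def sum_nonneg \<tau>0)
  have T1: "T i \<le> 1" if "i \<in> I" for i
    using le1[OF that] unfolding T_def \<tau>_def by (subst sum.swap) (simp add: w[OF that])
  \<comment> \<open>When \<tau> i k or \<open>T i\<close> is 0, division by zero returns 0, so the
    bounds \<open>a1\<close> and T i / T i <= 1 hold in the degenerate cases too.\<close>
  define a where "a = (\<lambda>(i, k) l. (w i k \<bullet> y l) / sqrt (\<tau> i k))"
  define q where "q = (\<lambda>(i, k). \<tau> i k / T i)"
  define J where "J = Sigma I K"
  have J: "finite J" using I K by (simp add: J_def)
  have Jsum: "(\<Sum>j\<in>J. h j) = (\<Sum>i\<in>I. \<Sum>k\<in>K i. h (i, k))" for h :: "_ \<Rightarrow> real"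
    using I K by (simp add: J_def sum.Sigma split_def)
  have q0: "0 \<le> q j" for j by (simp add: q_def \<tau>0 T0 split: prod.split)
  have a1: "(\<Sum>l\<in>C. (a j l)\<^sup>2) \<le> 1" for j
    by (simp add: a_def power_divide \<tau>0 split: prod.split flip: sum_divide_distrib \<tau>_def)
  have a2: "2 * c * (\<Sum>l\<in>C. (a j l)\<^sup>2) \<le> 2 * c" for j
    using mult_left_mono[OF a1[of j], of "2 * c"] c(1) unfolding mult_1_right by linarith
  have "\<exists>\<sigma>. (\<forall>k. \<sigma> k \<in> {-1, 1}) \<and>
     (\<Sum>j\<in>J. q j * gauss_mgf c 0 (\<Sum>k\<in>C. \<sigma> k * a j k))
       \<le> (\<Sum>j\<in>J. q j * gauss_mgf c (0 + (\<Sum>k\<in>C. (a j k)\<^sup>2)) 0)"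
    (is "\<exists>\<sigma>. ?P \<sigma> \<and> ?Q \<sigma>")
  proof (rule signs_gauss_mgf)
    show "2 * c * (0 + (\<Sum>k\<in>C. (a j k)\<^sup>2)) < 1" for j
      using a2[of j] c(2) unfolding add_0 by linarith
  qed (use C c q0 in auto)
  then obtain \<sigma> where "?P \<sigma>" "?Q \<sigma>" by blast
  then have \<sigma>: "\<And>k. \<sigma> k \<in> {-1, 1}" and
    le: "(\<Sum>j\<in>J. q j * gauss_mgf c 0 (\<Sum>k\<in>C. \<sigma> k * a j k))
       \<le> (\<Sum>j\<in>J. q j * gauss_mgf c (\<Sum>k\<in>C. (a j k)\<^sup>2) 0)" by simp_all
  have "(\<Sum>j\<in>J. q j * gauss_mgf c (\<Sum>k\<in>C. (a j k)\<^sup>2) 0) \<le> (\<Sum>j\<in>J. q j * (1 / sqrt (1 - 2 * c)))"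
  proof (intro sum_mono mult_left_mono q0)
    fix j
    show "gauss_mgf c (\<Sum>k\<in>C. (a j k)\<^sup>2) 0 \<le> 1 / sqrt (1 - 2 * c)"
      using c a2[of j] by (simp add: gauss_mgf_def frac_le)
  qed
  also have "\<dots> = (\<Sum>i\<in>I. T i / T i) / sqrt (1 - 2 * c)"
    unfolding sum_distrib_right[symmetric] Jsum by (simp add: q_def T_def flip: sum_divide_distrib)
  also have "\<dots> \<le> card I / sqrt (1 - 2 * c)"
  proof (rule divide_right_mono)
    have "(\<Sum>i\<in>I. T i / T i) \<le> (\<Sum>i\<in>I. 1)" by (intro sum_mono) simp
    then show "(\<Sum>i\<in>I. T i / T i) \<le> card I" by simp
  qed (use c in simp)
  \<comment> \<open>With no variance left, \<open>gauss_mgf c 0 u\<close> is just exp(c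
    u^2).\<close>
  finally have total: "(\<Sum>j\<in>J. q j * exp (c * (\<Sum>k\<in>C. \<sigma> k * a j k)\<^sup>2)) \<le> card I / sqrt (1 - 2 * c)"
    using le by (simp add: gauss_mgf_def)
  show thesis
  proof (rule that[OF \<sigma>])
    fix i z assume i: "i \<in> I" and z: "z = (\<Sum>k\<in>C. \<sigma> k *\<^sub>R y k)"
    define s where "s k = (\<Sum>l\<in>C. \<sigma> l * a (i, k) l)" for k
    have wz: "(w i k \<bullet> z)\<^sup>2 = \<tau> i k * (s k)\<^sup>2" for k
    proof (cases "\<tau> i k = 0")
      case True
      then have "w i k \<bullet> y l = 0" if "l \<in> C" for l
        using C that by (simp add: \<tau>_def sum_nonneg_eq_0_iff)
      then show ?thesis using True by (simp add: z inner_sum_right)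
    next
      case False
      have "s k = (w i k \<bullet> z) / sqrt (\<tau> i k)"
        by (simp add: s_def a_def z inner_sum_right sum_divide_distrib)
      then show ?thesis using False \<tau>0[of i k] by (simp add: power_divide)
    qed
    have Az: "z \<bullet> (A i *v z) = (\<Sum>k\<in>K i. \<tau> i k * (s k)\<^sup>2)" by (simp add: w[OF i] wz)
    show "exp (c * (z \<bullet> (A i *v z))) \<le> card I / sqrt (1 - 2 * c)"
    proof (cases "T i = 0")
      \<comment> \<open>Here the form vanishes at \<open>z\<close> and the left side is 1, so it
        suffices that the right side is at least 1.\<close>
      case True
      then have "\<tau> i k = 0" if "k \<in> K i" for k
        using K[OF i] that \<tau>0 by (simp add: T_def sum_nonneg_eq_0_iff)
      then have "z \<bullet> (A i *v z) = 0" by (simp add: Az)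
      moreover have "1 \<le> real (card I)" using I by (simp add: Suc_le_eq card_gt_0_iff)
      moreover have "sqrt (1 - 2 * c) \<le> 1" using c by simp
      ultimately have "sqrt (1 - 2 * c) \<le> real (card I)" by linarith
      then show ?thesis using c \<open>z \<bullet> (A i *v z) = 0\<close> by simp
    next
      case False
      have "exp (c * (z \<bullet> (A i *v z))) \<le> (\<Sum>k\<in>K i. \<tau> i k / T i * exp (c * (s k)\<^sup>2))"
        unfolding Az T_def
      proof (rule exp_sum_squares_le)
        show "0 < (\<Sum>k\<in>K i. \<tau> i k)" using T0[of i] False by (simp flip: T_def)
        show "(\<Sum>k\<in>K i. \<tau> i k) \<le> 1" using T1[OF i] by (simp add: T_def)
      qed (use K[OF i] c \<tau>0 in simp_all)
      also have "\<dots> \<le> (\<Sum>i\<in>I. \<Sum>k\<in>K i. q (i, k) * exp (c * (\<Sum>l\<in>C. \<sigma> l * a (i, k) l)\<^sup>2))"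
        using member_le_sum[OF i, of "\<lambda>i. \<Sum>k\<in>K i. q (i, k) * exp (c * (\<Sum>l\<in>C. \<sigma> l * a (i, k) l)\<^sup>2)"] I
        by (simp only: s_def) (simp add: q_def sum_nonneg \<tau>0 T0)
      also have "\<dots> \<le> card I / sqrt (1 - 2 * c)"
        using total unfolding Jsum .
      finally show ?thesis .
    qed
  qed
qed

text \<open>
  This choice of \<open>c\<close> minimises \<open>1 + c / (1 - 2 c) + L / c\<close>, which bounds
  \<open>(L - ln (1 - 2 c) / 2) / c\<close>.
\<close>

lemma tail_exponent_optimum:
  assumes "0 < L"
  defines "c \<equiv> sqrt L / (1 + 2 * sqrt L)"
  shows "0 < c" "2 * c < 1" "L + ln (1 / sqrt (1 - 2 * c)) \<le> c * (2 * L + 2 * sqrt L + 1)"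
proof -
  define q where "q = sqrt L"
  define r where "r = 1 + 2 * q"
  have q: "q > 0" "L = q\<^sup>2" using assms(1) by (auto simp: q_def)
  have c: "c = q / r" by (simp add: c_def q_def r_def)
  have r: "r > 1" using q by (simp add: r_def)
  show "0 < c" using q r by (simp add: c)
  show "2 * c < 1" using q r by (simp add: c r_def)
  have "1 - 2 * c = 1 / r" using r by (simp add: c r_def field_simps)
  then have "ln (1 / sqrt (1 - 2 * c)) = ln r / 2"
    using r by (simp add: real_sqrt_divide ln_sqrt)
  \<comment> \<open>ln r <= sinh(ln r) = (r - 1/r) / 2. This is the only loss; the remaining steps
    are equalities.\<close>
  also have "\<dots> \<le> (r - inverse r) / 4"
    using real_le_x_sinh[of "ln r"] r by simp
  also have "\<dots> = (q + q\<^sup>2) / r"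
    using r by (simp add: divide_simps) (simp add: r_def power2_eq_square algebra_simps)
  finally have "L + ln (1 / sqrt (1 - 2 * c)) \<le> q\<^sup>2 + (q + q\<^sup>2) / r" by (simp add: q(2))
  also have "\<dots> = c * (2 * L + 2 * sqrt L + 1)"
    unfolding c q_def[symmetric] q(2) using r
    by (simp add: divide_simps) (simp add: r_def power2_eq_square algebra_simps)
  finally show "L + ln (1 / sqrt (1 - 2 * c)) \<le> c * (2 * L + 2 * sqrt L + 1)" .
qed

text \<open>Take logarithms in the exponential bound and divide by the optimal \<open>c\<close>. At
  least two forms make \<open>L\<close>, and hence \<open>c\<close>, positive.\<close>

lemma signs_psd_bound:
  fixes A :: "'i \<Rightarrow> real^'k^'k" and y :: "'c \<Rightarrow> real^'k"
  assumes card: "card I \<ge> 2" and C: "finite C" and A: "\<And>i. i \<in> I \<Longrightarrow> psd (A i)"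
    and le1: "\<And>i. i \<in> I \<Longrightarrow> (\<Sum>c\<in>C. y c \<bullet> (A i *v y c)) \<le> 1"
  obtains \<sigma> :: "'c \<Rightarrow> real" where "\<And>k. \<sigma> k \<in> {-1, 1}"
    "\<And>i z. i \<in> I \<Longrightarrow> z = (\<Sum>k\<in>C. \<sigma> k *\<^sub>R y k) \<Longrightarrow>
       z \<bullet> (A i *v z) \<le> 2 * ln (card I) + 2 * sqrt (ln (card I)) + 1"
proof -
  define L where "L = ln (real (card I))"
  have L: "0 < L" using card by (simp add: L_def)
  have I: "finite I" "I \<noteq> {}" using card card.infinite by fastforce+
  define c where "c = sqrt L / (1 + 2 * sqrt L)"
  note c = tail_exponent_optimum[OF L, folded c_def]
  obtain \<sigma> :: "'c \<Rightarrow> real" where \<sigma>: "\<And>k. \<sigma> k \<in> {-1, 1}"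
    and ex: "\<And>i z. i \<in> I \<Longrightarrow> z = (\<Sum>k\<in>C. \<sigma> k *\<^sub>R y k) \<Longrightarrow>
       exp (c * (z \<bullet> (A i *v z))) \<le> card I / sqrt (1 - 2 * c)"
    using signs_psd_exp_bound[of I C A y c, OF I C A le1 c(1,2)] by blast
  show thesis
  proof (rule that[OF \<sigma>])
    fix i z assume "i \<in> I" "z = (\<Sum>k\<in>C. \<sigma> k *\<^sub>R y k)"
    from ex[OF this] have "c * (z \<bullet> (A i *v z)) \<le> ln (card I / sqrt (1 - 2 * c))"
      using c(2) card by (subst ln_ge_iff) auto
    also have "\<dots> = L + ln (1 / sqrt (1 - 2 * c))"
      using c(2) card by (simp add: L_def ln_div)
    also note c(3)
    finally have "z \<bullet> (A i *v z) \<le> 2 * L + 2 * sqrt L + 1" using c(1) by simp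
    then show "z \<bullet> (A i *v z) \<le> 2 * ln (card I) + 2 * sqrt (ln (card I)) + 1" by (simp add: L_def)
  qed
qed

section \<open>Conic duality\<close>

lemma psd_zero: "psd 0"
  by (simp add: psd_def sym_mats_def transpose_def vec_eq_iff)

lemma psd_add: "psd A \<Longrightarrow> psd B \<Longrightarrow> psd (A + B)"
  by (auto simp: psd_def sym_mats_def transpose_def vec_eq_iff matrix_vector_mult_add_rdistrib inner_add_right)

lemma psd_scaleR: "0 \<le> r \<Longrightarrow> psd A \<Longrightarrow> psd (r *\<^sub>R A)"
  by (auto simp: psd_def sym_mats_def transpose_def vec_eq_iff scaleR_matrix_vector_assoc[symmetric])

lemma psd_convex_comb: "0 \<le> u \<Longrightarrow> 0 \<le> v \<Longrightarrow> psd A \<Longrightarrow> psd B \<Longrightarrow> psd (u *\<^sub>R A + v *\<^sub>R B)"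
  by (intro psd_add psd_scaleR)

text \<open>If no such \<open>X\<close> exists, 0 lies outside the convex set \<open>K\<close> of
  value vectors, and a separating functional (\<alpha>, \<nu>) yields the multiplier -\<alpha> /
  \<nu>, contradicting infeasibility. The Slater matrix \<open>X0\<close> guarantees \<nu> >
  0.\<close>

lemma psd_duality:
  fixes G :: "'s::finite \<Rightarrow> real^'k^'k"
  assumes sym: "H \<in> sym_mats" "\<And>i. G i \<in> sym_mats"
    and slater: "psd X0" "\<And>i. 0 < G i \<bullet> X0"
    and infeasible: "\<nexists>l :: real^'s. (\<forall>i. 0 \<le> l $ i) \<and> psd (H - (\<Sum>i\<in>UNIV. l $ i *\<^sub>R G i))"
  obtains X where "psd X" "\<And>i. 0 \<le> G i \<bullet> X" "H \<bullet> X < 0"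
proof (rule ccontr)
  assume "\<not> thesis"
  define K where "K = {p :: (real^'s) \<times> real. \<exists>X. psd X \<and> (\<forall>i. fst p $ i \<le> G i \<bullet> X) \<and> H \<bullet> X < snd p}"
  have "convex K"
    unfolding convex_def
  proof (intro ballI allI impI)
    fix p q u v assume "p \<in> K" "q \<in> K" and uv: "0 \<le> u" "0 \<le> v" "u + v = (1::real)"
    then obtain X Y where X: "psd X" "\<And>i. fst p $ i \<le> G i \<bullet> X" "H \<bullet> X < snd p"
      and Y: "psd Y" "\<And>i. fst q $ i \<le> G i \<bullet> Y" "H \<bullet> Y < snd q" by (auto simp: K_def)
    have "u * (H \<bullet> X) + v * (H \<bullet> Y) < u * snd p + v * snd q"
    proof (cases "u = 0")
      case True then show ?thesis using Y uv by simp
    next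
      case False
      then show ?thesis using X Y uv
        by (intro add_less_le_mono mult_strict_left_mono mult_left_mono) auto
    qed
    moreover have "u * fst p $ i + v * fst q $ i \<le> u * (G i \<bullet> X) + v * (G i \<bullet> Y)" for i
      using X Y uv by (intro add_mono mult_left_mono) auto
    ultimately show "u *\<^sub>R p + v *\<^sub>R q \<in> K"
      unfolding K_def using X(1) Y(1) uv
      by (intro CollectI exI[of _ "u *\<^sub>R X + v *\<^sub>R Y"]) (auto simp: psd_convex_comb inner_add_right)
  qed
  moreover have "0 \<notin> K" using \<open>\<not> thesis\<close> that by (auto simp: K_def)
  ultimately obtain a where a: "a \<noteq> 0" "\<And>p. p \<in> K \<Longrightarrow> 0 \<le> a \<bullet> p"
    using separating_hyperplane_set_0[of K] by auto
  obtain \<alpha> \<nu> where a_eq: "a = (\<alpha>, \<nu>)" by (cases a)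
  have sep: "0 \<le> \<alpha> \<bullet> b + \<nu> * t" if "psd X" "\<And>i. b $ i \<le> G i \<bullet> X" "H \<bullet> X < t" for X b t
  proof -
    have "(b, t) \<in> K" using that by (auto simp: K_def)
    from a(2)[OF this] show ?thesis by (simp add: a_eq)
  qed
  have \<nu>: "0 \<le> \<nu>" using sep[OF psd_zero, of 0 1] by simp
  \<comment> \<open>\<open>K\<close> is closed under lowering the first components, so a positive
    \<alpha> $ i would make the functional negative on \<open>K\<close>.\<close>
  have \<alpha>: "\<alpha> $ i \<le> 0" for i
  proof (rule ccontr)
    assume "\<not> \<alpha> $ i \<le> 0"
    moreover define t where "t = (\<nu> + 1) / \<alpha> $ i"
    ultimately have "t \<ge> 0" "t * \<alpha> $ i = \<nu> + 1" using \<nu> by auto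
    moreover have "0 \<le> \<alpha> \<bullet> (axis i (- t)) + \<nu> * 1"
      using \<open>t \<ge> 0\<close> by (intro sep[OF psd_zero]) (auto simp: axis_def)
    ultimately show False by (simp add: inner_axis mult.commute)
  qed
  have pos: "0 \<le> (\<Sum>i\<in>UNIV. \<alpha> $ i * (G i \<bullet> X)) + \<nu> * (H \<bullet> X)" if X: "psd X" for X
  proof (rule field_le_epsilon)
    fix e :: real assume e: "e > 0"
    \<comment> \<open>The last inequality in \<open>K\<close> is strict, hence the slack e / (\<nu>
      + 1), whose contribution after multiplication by \<nu> stays below \<open>e\<close>.\<close>
    have "0 \<le> \<alpha> \<bullet> (\<chi> i. G i \<bullet> X) + \<nu> * (H \<bullet> X + e / (\<nu> + 1))"
      using e \<nu> by (intro sep[OF X]) auto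
    moreover have "\<nu> * (e / (\<nu> + 1)) \<le> e" using e \<nu> by (simp add: divide_simps)
    ultimately show "0 \<le> (\<Sum>i\<in>UNIV. \<alpha> $ i * (G i \<bullet> X)) + \<nu> * (H \<bullet> X) + e"
      by (simp add: inner_vec_def distrib_left)
  qed
  \<comment> \<open>With \<nu> = 0, nonpositive terms would have a nonnegative sum at
    \<open>X0\<close>; all vanish, forcing \<alpha> = 0.\<close>
  have "\<nu> \<noteq> 0"
  proof
    assume "\<nu> = 0"
    then have "0 \<le> (\<Sum>i\<in>UNIV. \<alpha> $ i * (G i \<bullet> X0))" using pos[OF slater(1)] by simp
    moreover have nonpos: "\<alpha> $ i * (G i \<bullet> X0) \<le> 0" for i
      using \<alpha>[of i] slater(2)[of i] by (simp add: mult_nonpos_nonneg)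
    ultimately have "(\<Sum>i\<in>UNIV. - (\<alpha> $ i * (G i \<bullet> X0))) = 0"
      using sum_nonpos[of UNIV "\<lambda>i. \<alpha> $ i * (G i \<bullet> X0)"] by (simp add: sum_negf)
    then have "\<alpha> $ i * (G i \<bullet> X0) = 0" for i
      using nonpos by (subst (asm) sum_nonneg_eq_0_iff) auto
    then have "\<alpha> = 0" using slater(2) by (auto simp: vec_eq_iff less_le)
    then show False using a(1) \<open>\<nu> = 0\<close> by (simp add: a_eq zero_prod_def)
  qed
  then have \<nu>': "\<nu> > 0" using \<nu> by simp
  define l where "l = (\<chi> i. - \<alpha> $ i / \<nu>)"
  have "psd (H - (\<Sum>i\<in>UNIV. l $ i *\<^sub>R G i))"
    unfolding psd_def
  proof (intro conjI allI)
    show "H - (\<Sum>i\<in>UNIV. l $ i *\<^sub>R G i) \<in> sym_mats"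
      using sym by (auto simp: sym_mats_def transpose_def vec_eq_iff)
    \<comment> \<open>Rank-one matrices turn the inequality \<open>pos\<close> into nonnegativity of
      the quadratic form.\<close>
    show "0 \<le> x \<bullet> ((H - (\<Sum>i\<in>UNIV. l $ i *\<^sub>R G i)) *v x)" for x
    proof -
      have "0 \<le> ((\<Sum>i\<in>UNIV. \<alpha> $ i * (G i \<bullet> outer x)) + \<nu> * (H \<bullet> outer x)) / \<nu>"
        using pos[OF psd_outer] \<nu>' by simp
      also have "\<dots> = (H - (\<Sum>i\<in>UNIV. l $ i *\<^sub>R G i)) \<bullet> outer x"
        using \<nu>' by (simp add: l_def inner_diff_left inner_add_left inner_sum_left add_divide_distrib sum_divide_distrib sum_negf)
      finally show ?thesis by (simp add: inner_outer)
    qed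
  qed
  moreover have "0 \<le> l $ i" for i using \<alpha>[of i] \<nu>' by (simp add: l_def divide_nonpos_pos)
  ultimately show False using infeasible by blast
qed

section \<open>Quadratic forms of signed sums\<close>

text \<open>Greedy choice: each new sign makes the cross term with the previous partial sum
  nonnegative.\<close>

lemma signs_quadratic_ge:
  fixes G :: "real^'k^'k" and y :: "'c \<Rightarrow> real^'k"
  assumes "finite C"
  shows "\<exists>\<sigma>. (\<forall>k. \<sigma> k \<in> {-1, 1}) \<and>
    (\<Sum>k\<in>C. y k \<bullet> (G *v y k)) \<le> (\<Sum>k\<in>C. \<sigma> k *\<^sub>R y k) \<bullet> (G *v (\<Sum>k\<in>C. \<sigma> k *\<^sub>R y k))"
  using assms
proof (induction C rule: finite_induct)
  case empty
  show ?case by (intro exI[of _ "\<lambda>_. 1"]) simp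
next
  case (insert k C)
  then obtain \<sigma> where \<sigma>: "\<forall>k. \<sigma> k \<in> {-1, 1}" and
    le: "(\<Sum>k\<in>C. y k \<bullet> (G *v y k)) \<le> (\<Sum>k\<in>C. \<sigma> k *\<^sub>R y k) \<bullet> (G *v (\<Sum>k\<in>C. \<sigma> k *\<^sub>R y k))" by blast
  define z where "z = (\<Sum>k\<in>C. \<sigma> k *\<^sub>R y k)"
  define r where "r = z \<bullet> (G *v y k) + y k \<bullet> (G *v z)"
  define s :: real where "s = (if 0 \<le> r then 1 else -1)"
  have ss: "s * s = 1" by (simp add: s_def)
  have "(\<Sum>i\<in>insert k C. (\<sigma>(k := s)) i *\<^sub>R y i) = s *\<^sub>R y k + z"
    using insert.hyps by (auto simp: z_def intro!: sum.cong)
  moreover have "(s *\<^sub>R y k + z) \<bullet> (G *v (s *\<^sub>R y k + z)) = z \<bullet> (G *v z) + y k \<bullet> (G *v y k) + s * r"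
    using ss by (simp add: r_def matrix_vector_right_distrib matrix_vector_mult_scaleR inner_add
        distrib_left flip: mult.assoc)
  moreover have "0 \<le> s * r" by (simp add: s_def)
  ultimately show ?case
    using insert.hyps le \<sigma> by (intro exI[of _ "\<sigma>(k := s)"]) (auto simp: z_def[symmetric] s_def)
qed

text \<open>The mixed terms vanish and squared signs are 1. Hence the signs can be spent on the
  constraints without changing the objective.\<close>

lemma signs_quadratic_orthogonal:
  fixes A :: "real^'k^'k" and y :: "'c \<Rightarrow> real^'k"
  assumes C: "finite C" and orth: "\<And>c d. c \<in> C \<Longrightarrow> d \<in> C \<Longrightarrow> c \<noteq> d \<Longrightarrow> y c \<bullet> (A *v y d) = 0"
    and \<sigma>: "\<And>k. \<sigma> k \<in> {-1, 1}"
  shows "(\<Sum>k\<in>C. \<sigma> k *\<^sub>R y k) \<bullet> (A *v (\<Sum>k\<in>C. \<sigma> k *\<^sub>R y k)) = (\<Sum>k\<in>C. y k \<bullet> (A *v y k))"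
proof -
  have "(\<Sum>k\<in>C. \<sigma> k *\<^sub>R y k) \<bullet> (A *v (\<Sum>k\<in>C. \<sigma> k *\<^sub>R y k))
      = (\<Sum>c\<in>C. \<Sum>d\<in>C. \<sigma> c * \<sigma> d * (y c \<bullet> (A *v y d)))"
    by (simp add: inner_sum_left inner_sum_right linear_sum[OF matrix_vector_mul_linear]
        matrix_vector_mult_scaleR sum_distrib_left mult_ac)
      (subst sum.swap, simp add: mult_ac)
  also have "\<dots> = (\<Sum>c\<in>C. \<Sum>d\<in>C. if d = c then y c \<bullet> (A *v y c) else 0)"
  proof (intro sum.cong refl)
    fix c d assume "c \<in> C" "d \<in> C"
    then show "\<sigma> c * \<sigma> d * (y c \<bullet> (A *v y d)) = (if d = c then y c \<bullet> (A *v y c) else 0)"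
      using orth[of c d] \<sigma>[of c] by auto
  qed
  finally show ?thesis using C by simp
qed

section \<open>The approximate S-lemma\<close>

definition tail_vec :: "real^('n::finite) option \<Rightarrow> real^'n" where
  "tail_vec v = (\<chi> j. v $ Some j)"

lemma sum_option: "(\<Sum>i\<in>UNIV. f i) = f None + (\<Sum>j\<in>UNIV. f (Some (j::'n::finite)))"
  by (simp add: UNIV_option_conv sum.reindex)

lemma ext_vec_None [simp]: "ext_vec z $ None = 1"
  and tail_ext_vec [simp]: "tail_vec (ext_vec z) = z"
  by (simp_all add: ext_vec_def tail_vec_def vec_eq_iff)

lemma tail_vec_scaleR [simp]: "tail_vec (r *\<^sub>R v) = r *\<^sub>R tail_vec v"
  by (simp add: tail_vec_def vec_eq_iff)

lemma vec_option_eq_iff: "v = w \<longleftrightarrow> v $ None = w $ None \<and> tail_vec v = tail_vec w"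
  by (auto simp: tail_vec_def vec_eq_iff split_option_all)

lemma quadratic_option:
  fixes A :: "real^('n::finite) option^'n option"
  assumes "A \<in> sym_mats"
  shows "v \<bullet> (A *v v) = A $ None $ None * (v $ None)\<^sup>2
     + 2 * v $ None * ((\<chi> j. A $ None $ Some j) \<bullet> tail_vec v)
     + tail_vec v \<bullet> ((\<chi> j k. A $ Some j $ Some k) *v tail_vec v)"
proof -
  have A: "A $ Some j $ None = A $ None $ Some j" for j
    using assms by (auto simp: sym_mats_def transpose_def vec_eq_iff)
  show ?thesis
    by (simp add: inner_vec_def matrix_vector_mult_def tail_vec_def sum_option A
        distrib_left sum.distrib sum_distrib_left power2_eq_square mult_ac)
qed

lemma block_mat_sym: "D \<in> sym_mats \<Longrightarrow> block_mat a 0 0 D \<in> sym_mats"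
  by (auto simp: sym_mats_def transpose_def vec_eq_iff block_mat_def split: option.splits)

lemma block_mat_quadratic:
  "v \<bullet> (block_mat a 0 0 D *v v) = a * (v $ None)\<^sup>2 + tail_vec v \<bullet> (D *v tail_vec v)"
  by (simp add: inner_vec_def matrix_vector_mult_def tail_vec_def sum_option block_mat_def
        distrib_left sum_distrib_left power2_eq_square mult_ac)

text \<open>Serves to exclude homogeneous solutions with first coordinate 0, that is, directions at
  infinity of the disturbance set.\<close>

lemma posdef_sum_eq_zero:
  fixes Q :: "'s::finite \<Rightarrow> real^'n^'n"
  assumes "posdef (\<Sum>i\<in>UNIV. Q i)" "\<And>i. z \<bullet> (Q i *v z) \<le> 0"
  shows "z = 0"
proof (rule ccontr)
  assume "z \<noteq> 0"
  then have "0 < z \<bullet> ((\<Sum>i\<in>UNIV. Q i) *v z)" using assms(1) by (simp add: posdef_def)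
  also have "z \<bullet> ((\<Sum>i\<in>UNIV. Q i) *v z) = (\<Sum>i\<in>UNIV. (Q i) \<bullet> outer z)"
    by (simp add: inner_sum_left flip: inner_outer)
  also have "\<dots> \<le> 0" using assms(2) by (intro sum_nonpos) (simp add: inner_outer)
  finally show False by simp
qed

lemma Theta_ge_1: "1 \<le> Theta s"
  by (simp add: Theta_def)

text \<open>Everything is homogenised: \<open>E\<close> replaces the constant 1, \<open>G i\<close>
  encodes the i-th constraint and \<open>H\<close> the bound \<gamma>. The signed sum
  \<open>v\<close> must be brought back to first coordinate 1. For one constraint this is division
  by that coordinate; for several, the tail is divided by the root of \<Theta>.\<close>

lemma approximate_S_lemma:
  fixes Q :: "'s::finite \<Rightarrow> real^'n^'n" and R :: "real^'n option^'n option"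
  assumes Q_psd: "\<And>i. psd (Q i)" and Q_sum: "posdef (\<Sum>i\<in>UNIV. Q i)" and R: "R \<in> sym_mats"
    and infeasible: "\<nexists>l :: real^'s. (\<forall>i. 0 \<le> l $ i) \<and>
      psd (block_mat (\<gamma> - (\<Sum>i\<in>UNIV. l $ i)) 0 0 (\<Sum>i\<in>UNIV. l $ i *\<^sub>R Q i) - R)"
    and \<epsilon>: "\<epsilon> > 0"
  shows "\<exists>z\<in>disturbance_set Q.
     gamma_minus CARD('s) \<epsilon> \<gamma> (R $ None $ None) < ext_vec z \<bullet> (R *v ext_vec z)"
proof -
  define E :: "real^'n option^'n option" where "E = block_mat 1 0 0 0"
  define G where "G i = block_mat 1 0 0 (- Q i)" for i
  define H where "H = \<gamma> *\<^sub>R E - R"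
  have Qs: "Q i \<in> sym_mats" for i using Q_psd by (simp add: psd_def)
  have E_eq: "E = outer (axis None 1)"
    by (simp add: E_def block_mat_def outer_def vec_eq_iff axis_def split: option.split)
  have Es: "E \<in> sym_mats" and Ep: "psd E"
    using psd_outer[of "axis None 1 :: real^'n option"] by (simp_all add: E_eq psd_def)
  have Gs: "G i \<in> sym_mats" for i
    unfolding G_def using Qs[of i]
    by (intro block_mat_sym) (auto simp: sym_mats_def transpose_def vec_eq_iff)
  have Hs: "H \<in> sym_mats"
    using R Es by (auto simp: H_def sym_mats_def transpose_def vec_eq_iff)
  have Eq: "v \<bullet> (E *v v) = (v $ None)\<^sup>2" for v
    by (simp add: E_def block_mat_quadratic)
  have Gq: "v \<bullet> (G i *v v) = (v $ None)\<^sup>2 - tail_vec v \<bullet> (Q i *v tail_vec v)" for i v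
  proof -
    have "w \<bullet> ((- Q i) *v w) = - (w \<bullet> (Q i *v w))" for w by (simp flip: inner_outer)
    then show ?thesis by (simp add: G_def block_mat_quadratic)
  qed
  have Hq: "v \<bullet> (H *v v) = \<gamma> * (v $ None)\<^sup>2 - v \<bullet> (R *v v)" for v
    by (simp add: H_def inner_diff_left inner_diff_right matrix_vector_mult_diff_rdistrib Eq
        flip: scaleR_matrix_vector_assoc)
  \<comment> \<open>\<open>E\<close> is the Slater matrix: it corresponds to the zero disturbance,
    which satisfies every constraint strictly.\<close>
  have pos_GE: "0 < G i \<bullet> E" for i
    unfolding E_eq inner_outer Gq by (simp add: tail_vec_def axis_def) (simp flip: zero_vec_def)
  have "H - (\<Sum>i\<in>UNIV. l $ i *\<^sub>R G i)
      = block_mat (\<gamma> - (\<Sum>i\<in>UNIV. l $ i)) 0 0 (\<Sum>i\<in>UNIV. l $ i *\<^sub>R Q i) - R" for l :: "real^'s"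
    by (simp add: H_def G_def E_def block_mat_def vec_eq_iff sum_negf split: option.split)
  then have infeasible': "\<nexists>l :: real^'s. (\<forall>i. 0 \<le> l $ i) \<and> psd (H - (\<Sum>i\<in>UNIV. l $ i *\<^sub>R G i))"
    using infeasible by simp
  obtain X where X: "psd X" "\<And>i. 0 \<le> G i \<bullet> X" "H \<bullet> X < 0"
    using psd_duality[OF Hs Gs Ep pos_GE infeasible'] by blast
  show ?thesis
  proof (cases "CARD('s) = 1")
    case True
    obtain C and y :: "real^'n option \<Rightarrow> real^'n option" where C: "finite C"
      and orth: "\<And>c d. c \<in> C \<Longrightarrow> d \<in> C \<Longrightarrow> c \<noteq> d \<Longrightarrow> y c \<bullet> (H *v y d) = 0"
      and tr: "\<And>G. G \<bullet> X = (\<Sum>c\<in>C. y c \<bullet> (G *v y c))"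
      using psd_orthogonal_decomposition[OF X(1) Hs] by blast
    obtain i0 :: 's where UN: "UNIV = {i0}" using True by (auto simp: card_1_singleton_iff)
    obtain \<sigma> where \<sigma>: "\<And>k. \<sigma> k \<in> {-1, 1}" and
      ge: "(\<Sum>k\<in>C. y k \<bullet> (G i0 *v y k)) \<le> (\<Sum>k\<in>C. \<sigma> k *\<^sub>R y k) \<bullet> (G i0 *v (\<Sum>k\<in>C. \<sigma> k *\<^sub>R y k))"
      using signs_quadratic_ge[OF C, of y "G i0"] by blast
    define v where "v = (\<Sum>k\<in>C. \<sigma> k *\<^sub>R y k)"
    have Hv: "v \<bullet> (H *v v) < 0"
      using signs_quadratic_orthogonal[OF C orth \<sigma>] X(3) by (simp add: v_def tr)
    have Gv: "tail_vec v \<bullet> (Q i *v tail_vec v) \<le> (v $ None)\<^sup>2" for i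
    proof -
      have "i = i0" using UN by auto
      moreover have "0 \<le> v \<bullet> (G i0 *v v)" using ge X(2)[of i0] by (simp add: v_def tr)
      ultimately show ?thesis by (simp add: Gq)
    qed
    \<comment> \<open>A zero first coordinate would force \<open>v = 0\<close>, against the strict
      inequality \<open>Hv\<close>.\<close>
    have t: "v $ None \<noteq> 0"
    proof
      assume 0: "v $ None = 0"
      then have "tail_vec v = 0" using Gv by (intro posdef_sum_eq_zero[OF Q_sum]) simp
      then have "v = 0" using 0 by (simp add: vec_option_eq_iff) (simp add: tail_vec_def vec_eq_iff)
      then show False using Hv by simp
    qed
    define z where "z = (1 / v $ None) *\<^sub>R tail_vec v"
    have ez: "ext_vec z = (1 / v $ None) *\<^sub>R v"
      using t by (simp add: vec_option_eq_iff z_def)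
    have "z \<in> disturbance_set Q"
      using Gv t by (simp add: disturbance_set_def z_def matrix_vector_mult_scaleR inner_commute
         divide_le_eq flip: power2_eq_square)
    moreover have "ext_vec z \<bullet> (H *v ext_vec z) < 0"
      using Hv t by (simp add: ez matrix_vector_mult_scaleR divide_less_0_iff zero_less_mult_iff flip: power2_eq_square)
    ultimately show ?thesis
      using True by (intro bexI[of _ z]) (simp_all add: Hq gamma_minus_def)
  next
    case False
    define \<Psi> where "\<Psi> = R $ None $ None"
    \<comment> \<open>Removing the value \<Psi> at the zero disturbance leaves a form that is linear
      in the first coordinate; the final rescaling relies on this.\<close>
    define P where "P = R - \<Psi> *\<^sub>R E"
    have Ps: "P \<in> sym_mats"
      using R Es by (auto simp: P_def sym_mats_def transpose_def vec_eq_iff)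
    have Pq: "v \<bullet> (P *v v) = v \<bullet> (R *v v) - \<Psi> * (v $ None)\<^sup>2" for v
      by (simp add: P_def inner_diff_left inner_diff_right matrix_vector_mult_diff_rdistrib Eq
          flip: scaleR_matrix_vector_assoc)
    have P0: "P $ None $ None = 0" by (simp add: P_def E_def block_mat_def \<Psi>_def)
    obtain C and y :: "real^'n option \<Rightarrow> real^'n option" where C: "finite C"
      and orth: "\<And>c d. c \<in> C \<Longrightarrow> d \<in> C \<Longrightarrow> c \<noteq> d \<Longrightarrow> y c \<bullet> (P *v y d) = 0"
      and tr: "\<And>G. G \<bullet> X = (\<Sum>c\<in>C. y c \<bullet> (G *v y c))"
      using psd_orthogonal_decomposition[OF X(1) Ps] by blast
    have QX: "(\<Sum>c\<in>C. tail_vec (y c) \<bullet> (Q i *v tail_vec (y c))) \<le> E \<bullet> X" for i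
      using X(2)[of i] by (simp add: tr Gq Eq sum_subtractf)
    have Q0: "0 \<le> z \<bullet> (Q i *v z)" for i z using Q_psd[of i] by (simp add: psd_def)
    \<comment> \<open>Otherwise all first coordinates vanish, then all tails by definiteness of the
      sum, and \<open>H\<close> could not be negative on \<open>X\<close>.\<close>
    have "0 < E \<bullet> X"
    proof (rule ccontr)
      assume "\<not> 0 < E \<bullet> X"
      then have E0: "(\<Sum>c\<in>C. (y c $ None)\<^sup>2) \<le> 0" by (simp add: tr Eq)
      have "y c = 0" if c: "c \<in> C" for c
      proof -
        have "(y c $ None)\<^sup>2 \<le> 0"
          using member_le_sum[OF c, of "\<lambda>c. (y c $ None)\<^sup>2"] C E0 zero_le_power2 by (meson order_trans)
        moreover have "tail_vec (y c) = 0"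
        proof (rule posdef_sum_eq_zero[OF Q_sum])
          fix i
          show "tail_vec (y c) \<bullet> (Q i *v tail_vec (y c)) \<le> 0"
            using member_le_sum[OF c, of "\<lambda>c. tail_vec (y c) \<bullet> (Q i *v tail_vec (y c))"] C Q0 QX[of i]
              \<open>\<not> 0 < E \<bullet> X\<close> by simp
        qed
        ultimately show ?thesis by (simp add: vec_option_eq_iff) (simp add: tail_vec_def vec_eq_iff)
      qed
      then have "H \<bullet> X = 0" by (simp add: tr)
      then show False using X(3) by simp
    qed
    define e where "e = E \<bullet> X"
    have e: "e > 0" using \<open>0 < E \<bullet> X\<close> by (simp add: e_def)
    define x where "x c = (1 / sqrt e) *\<^sub>R y c" for c
    have xq: "x c \<bullet> (A *v x c) = (y c \<bullet> (A *v y c)) / e" for A c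
      using e by (simp add: x_def matrix_vector_mult_scaleR)
    \<comment> \<open>The index \<open>None\<close> adds the constraint that the squared first
      coordinate is at most 1, so there are s + 1 forms; this is the s + 1 in \<Theta>.\<close>
    define A where "A = (\<lambda>None \<Rightarrow> E | Some i \<Rightarrow> block_mat 0 0 0 (Q i))"
    have Aq: "v \<bullet> (A (Some i) *v v) = tail_vec v \<bullet> (Q i *v tail_vec v)" for v i
      by (simp add: A_def block_mat_quadratic)
    have A: "psd (A i)" for i
    proof (cases i)
      case None then show ?thesis using Ep by (simp add: A_def)
    next
      case (Some j)
      have "A i \<in> sym_mats" using Qs by (simp add: Some A_def block_mat_sym)
      then show ?thesis unfolding psd_def using Aq Q0 by (simp add: Some)
    qed
    have A1: "(\<Sum>c\<in>C. x c \<bullet> (A i *v x c)) \<le> 1" for i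
    proof (cases i)
      case None then show ?thesis using e by (simp add: A_def xq e_def tr flip: sum_divide_distrib)
    next
      case (Some j)
      then show ?thesis
        using QX[of j] e unfolding Some xq by (simp add: Aq e_def divide_le_eq flip: sum_divide_distrib)
    qed
    have card: "card (UNIV :: 's option set) = CARD('s) + 1"
      by (simp add: UNIV_option_conv card_image)
    have card2: "2 \<le> card (UNIV :: 's option set)"
      unfolding card using zero_less_card_finite[where 'a='s] by linarith
    obtain \<sigma> where \<sigma>: "\<And>k. \<sigma> k \<in> {-1, 1}" and
      bd: "\<And>i v. v = (\<Sum>k\<in>C. \<sigma> k *\<^sub>R x k) \<Longrightarrow> v \<bullet> (A i *v v) \<le> Theta CARD('s)"
      using signs_psd_bound[of UNIV C A x, OF card2 C A A1] unfolding card Theta_def by (auto simp: add.commute)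
    define v where "v = (\<Sum>k\<in>C. \<sigma> k *\<^sub>R x k)"
    define \<Theta> where "\<Theta> = Theta CARD('s)"
    have \<Theta>: "\<Theta> > 0" using Theta_ge_1[of "CARD('s)"] by (simp add: \<Theta>_def)
    have v0: "(v $ None)\<^sup>2 \<le> \<Theta>" using bd[OF v_def, of None] by (simp add: A_def Eq \<Theta>_def)
    have vQ: "tail_vec v \<bullet> (Q i *v tail_vec v) \<le> \<Theta>" for i
      using bd[OF v_def, of "Some i"] by (simp add: Aq \<Theta>_def)
    have "\<gamma> - \<Psi> < v \<bullet> (P *v v)"
    proof -
      have "v \<bullet> (P *v v) = (\<Sum>c\<in>C. x c \<bullet> (P *v x c))"
        unfolding v_def
        by (rule signs_quadratic_orthogonal[OF C _ \<sigma>]) (simp add: x_def matrix_vector_mult_scaleR orth)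
      also have "\<dots> = (P \<bullet> X) / e" by (simp add: xq tr sum_divide_distrib)
      also have "P \<bullet> X = \<gamma> * e - \<Psi> * e - H \<bullet> X" by (simp add: P_def H_def e_def inner_diff_left)
      also have "\<dots> / e > \<gamma> - \<Psi>" using e X(3) by (simp add: less_divide_eq algebra_simps)
      finally show ?thesis .
    qed
    define p where "p = (\<chi> j. P $ None $ Some j)"
    define D where "D = (\<chi> j k. P $ Some j $ Some k)"
    have Pq2: "u \<bullet> (P *v u) = 2 * u $ None * (p \<bullet> tail_vec u) + tail_vec u \<bullet> (D *v tail_vec u)" for u
      by (simp add: quadratic_option[OF Ps] P0 p_def D_def)
    \<comment> \<open>Replace the first coordinate of \<open>v\<close> by the root of \<Theta>,
      which dominates its absolute value, and give the tail the sign \<open>r\<close>. The linear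
      term of \<open>P\<close> does not decrease and the quadratic term is unchanged; dividing by
      the root of \<Theta> then gives \<open>ext_vec z\<close>.\<close>
    define r :: real where "r = (if 0 \<le> p \<bullet> tail_vec v then 1 else -1)"
    have rr: "r * r = 1" by (simp add: r_def)
    define z where "z = (r / sqrt \<Theta>) *\<^sub>R tail_vec v"
    have zq: "z \<bullet> (B *v z) = (tail_vec v \<bullet> (B *v tail_vec v)) / \<Theta>" for B
      using \<Theta> rr by (simp add: z_def matrix_vector_mult_scaleR)
    have "z \<in> disturbance_set Q"
      using vQ \<Theta> by (simp add: disturbance_set_def inner_commute[of _ z] zq)
    moreover have "(v \<bullet> (P *v v)) / \<Theta> \<le> ext_vec z \<bullet> (P *v ext_vec z)"
    proof -
      have "\<bar>v $ None\<bar> \<le> sqrt \<Theta>" using v0 by (simp add: real_le_rsqrt)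
      have "v $ None * (p \<bullet> tail_vec v) \<le> \<bar>v $ None\<bar> * \<bar>p \<bullet> tail_vec v\<bar>"
        by (metis abs_ge_self abs_mult)
      also have "\<dots> \<le> sqrt \<Theta> * \<bar>p \<bullet> tail_vec v\<bar>"
        using \<open>\<bar>v $ None\<bar> \<le> sqrt \<Theta>\<close> by (intro mult_right_mono) auto
      also have "\<bar>p \<bullet> tail_vec v\<bar> = r * (p \<bullet> tail_vec v)" by (simp add: r_def)
      finally have "v $ None * (p \<bullet> tail_vec v) / \<Theta> \<le> sqrt \<Theta> * (r * (p \<bullet> tail_vec v)) / \<Theta>"
        using \<Theta> by (intro divide_right_mono) auto
      also have "\<dots> = p \<bullet> z"
        using \<Theta> by (simp add: z_def divide_simps)
      finally show ?thesis
        unfolding Pq2 by (simp add: zq add_divide_distrib)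
    qed
    moreover have "(\<gamma> - \<Psi>) / \<Theta> < (v \<bullet> (P *v v)) / \<Theta>"
      using \<open>\<gamma> - \<Psi> < v \<bullet> (P *v v)\<close> \<Theta> by (intro divide_strict_right_mono)
    ultimately show ?thesis
      using False \<epsilon> by (intro bexI[of _ z]) (simp_all add: gamma_minus_def Pq \<Psi>_def[symmetric] \<Theta>_def)
  qed
qed

section \<open>The robust constraint\<close>

text \<open>With \<open>e\<close> the first unit vector this is e m^T + m e^T. Since extended
  vectors have first coordinate 1, its quadratic form there is the linear term 2 (m . v).\<close>

definition cross_mat :: "real^('n::finite) option \<Rightarrow> real^'n option^'n option" where
  "cross_mat m = (\<chi> i j. (if i = None then m $ j else 0) + (if j = None then m $ i else 0))"

lemma cross_mat_sym: "cross_mat m \<in> sym_mats"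
  by (simp add: cross_mat_def sym_mats_def transpose_def vec_eq_iff add.commute)

lemma cross_mat_quadratic: "v \<bullet> (cross_mat m *v v) = 2 * v $ None * (m \<bullet> v)"
  by (subst quadratic_option[OF cross_mat_sym])
     (simp add: cross_mat_def inner_vec_def matrix_vector_mult_def sum_option tail_vec_def
       power2_eq_square algebra_simps)

lemma sym_mats_add: "A \<in> sym_mats \<Longrightarrow> B \<in> sym_mats \<Longrightarrow> A + B \<in> sym_mats"
  by (simp add: sym_mats_def transpose_def vec_eq_iff)

lemma robust_obj_eq:
  "robust_obj \<beta> M V x z = ext_vec z \<bullet> ((V x + cross_mat (\<beta> v* M x)) *v ext_vec z)"
  by (simp add: robust_obj_def matrix_vector_mult_add_rdistrib inner_add_right cross_mat_quadratic
      dot_lmul_matrix)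

section \<open>Entries of the blocks of F\<close>

lemma delta_nth: "delta X $ j $ k = X $ Some j $ Some k"
  by (simp add: delta_def matrix_matrix_mult_def transpose_def Pi_h_def
      if_distrib if_distribR cong: if_cong)

lemma rowvector_mult_nth: "(rowvector \<beta> ** B) $ 1 $ j = (\<beta> v* B) $ j"
  by (simp add: matrix_matrix_mult_def vector_matrix_mult_def rowvector_def mult.commute)

lemma mult_Pi_h_nth: "(B ** Pi_h) $ i $ j = B $ i $ Some j"
  by (simp add: matrix_matrix_mult_def Pi_h_def if_distrib if_distribR cong: if_cong)

lemma mult_Pi_c_nth: "(B ** Pi_c) $ i $ j = B $ i $ None"
  by (simp add: matrix_matrix_mult_def Pi_c_def if_distrib if_distribR cong: if_cong)

lemma transpose_Pi_c_mult_nth: "(transpose Pi_c ** B) $ i $ j = B $ None $ j"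
  by (simp add: matrix_matrix_mult_def transpose_def Pi_c_def if_distrib if_distribR cong: if_cong)

lemma phiT_nth: "phiT \<beta> M X x $ 1 $ j = X $ None $ Some j + (\<beta> v* M x) $ Some j"
  by (simp add: phiT_def mult_Pi_h_nth rowvector_mult_nth transpose_Pi_c_mult_nth)

lemma psi_eq: "psi \<beta> M X x = (X + cross_mat (\<beta> v* M x)) $ None $ None"
  by (simp add: psi_def mult_Pi_c_nth rowvector_mult_nth transpose_Pi_c_mult_nth cross_mat_def)

text \<open>The blocks \<psi>, \<phi>, \<delta> are exactly the blocks of \<open>X\<close> plus the
  cross matrix. This is the form needed for the S-lemma, and it displays F as affine in \<gamma>,
  \<lambda>, \<open>X\<close> and \<open>M x\<close>.\<close>

lemma F_mat_eq:
  assumes "X \<in> sym_mats"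
  shows "F_mat Q \<beta> M (\<gamma>, l, X, x) =
    block_mat (\<gamma> - (\<Sum>i\<in>UNIV. l $ i)) 0 0 (\<Sum>i\<in>UNIV. l $ i *\<^sub>R Q i) - (X + cross_mat (\<beta> v* M x))"
proof -
  have "X $ Some j $ None = X $ None $ Some j" for j
    using assms by (auto simp: sym_mats_def transpose_def vec_eq_iff)
  then show ?thesis
    by (auto simp: F_mat_def vec_eq_iff block_mat_def transpose_def phiT_nth psi_eq delta_nth
        cross_mat_def split: option.split)
qed

text \<open>Weak duality: evaluate both semidefinite constraints at \<open>ext_vec z\<close>; on the
  disturbance set the weighted \<open>Q\<close> terms are at most the sum of the
  multipliers.\<close>

lemma feasible_imp_robust:
  assumes "(\<gamma>, l, X, x) \<in> feasible_set Q \<beta> M V" and z: "z \<in> disturbance_set Q"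
  shows "robust_obj \<beta> M V x z \<le> \<gamma>"
proof -
  have X: "X \<in> sym_mats" "psd (F_mat Q \<beta> M (\<gamma>, l, X, x))" "\<And>i. 0 \<le> l $ i" "psd (X - V x)"
    using assms(1) by (auto simp: feasible_set_def loewner_le_def)
  let ?e = "ext_vec z" and ?m = "cross_mat (\<beta> v* M x)"
  have "0 \<le> ?e \<bullet> ((X - V x) *v ?e)" using X(4) by (simp add: psd_def)
  then have "robust_obj \<beta> M V x z \<le> ?e \<bullet> ((X + ?m) *v ?e)"
    by (simp add: robust_obj_eq matrix_vector_mult_add_rdistrib matrix_vector_mult_diff_rdistrib
        inner_add_right inner_diff_right)
  moreover have "0 \<le> ?e \<bullet> (F_mat Q \<beta> M (\<gamma>, l, X, x) *v ?e)" using X(2) by (simp add: psd_def)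
  then have "?e \<bullet> ((X + ?m) *v ?e) \<le> \<gamma> - (\<Sum>i\<in>UNIV. l $ i) + z \<bullet> ((\<Sum>i\<in>UNIV. l $ i *\<^sub>R Q i) *v z)"
    unfolding F_mat_eq[OF X(1)] matrix_vector_mult_diff_rdistrib inner_diff_right block_mat_quadratic
    by simp
  moreover have "z \<bullet> ((\<Sum>i\<in>UNIV. l $ i *\<^sub>R Q i) *v z) \<le> (\<Sum>i\<in>UNIV. l $ i)"
  proof -
    have "z \<bullet> ((\<Sum>i\<in>UNIV. l $ i *\<^sub>R Q i) *v z) = (\<Sum>i\<in>UNIV. l $ i * (z \<bullet> (Q i *v z)))"
      by (simp add: inner_sum_left flip: inner_outer)
    also have "\<dots> \<le> (\<Sum>i\<in>UNIV. l $ i * 1)"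
      using z X(3) by (intro sum_mono mult_left_mono) (auto simp: disturbance_set_def inner_commute)
    finally show ?thesis by simp
  qed
  ultimately show ?thesis by linarith
qed

lemma convex_feasible_set:
  assumes M: "affine_map M" and V: "matrix_convex V"
  shows "convex (feasible_set Q \<beta> M V)"
proof (rule convexI)
  fix p q and u v :: real
  assume pq: "p \<in> feasible_set Q \<beta> M V" "q \<in> feasible_set Q \<beta> M V" and uv: "0 \<le> u" "0 \<le> v" "u + v = 1"
  obtain \<gamma> l X x where p: "p = (\<gamma>, l, X, x)" by (cases p)
  obtain \<gamma>' l' X' x' where q: "q = (\<gamma>', l', X', x')" by (cases q)
  have X: "X \<in> sym_mats" "psd (F_mat Q \<beta> M (\<gamma>, l, X, x))" "\<And>i. 0 \<le> l $ i" "psd (X - V x)"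
    using pq by (auto simp: feasible_set_def loewner_le_def p)
  have X': "X' \<in> sym_mats" "psd (F_mat Q \<beta> M (\<gamma>', l', X', x'))" "\<And>i. 0 \<le> l' $ i" "psd (X' - V x')"
    using pq by (auto simp: feasible_set_def loewner_le_def q)
  have sym: "u *\<^sub>R X + v *\<^sub>R X' \<in> sym_mats"
    using X(1) X'(1) by (simp add: sym_mats_def transpose_def vec_eq_iff)
  obtain L c where L: "linear L" "\<And>x. M x = L x + c" using M by (auto simp: affine_map_def)
  \<comment> \<open>The translation part is written with the coefficient 1 - (u + v), which is
    0.\<close>
  have "M (u *\<^sub>R x + v *\<^sub>R x') = u *\<^sub>R M x + v *\<^sub>R M x' + (1 - (u + v)) *\<^sub>R c"
    by (simp add: L linear_add linear_scale algebra_simps)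
  then have Mc: "M (u *\<^sub>R x + v *\<^sub>R x') = u *\<^sub>R M x + v *\<^sub>R M x'" using uv by simp
  have mc: "\<beta> v* M (u *\<^sub>R x + v *\<^sub>R x') = u *\<^sub>R (\<beta> v* M x) + v *\<^sub>R (\<beta> v* M x')"
    by (simp add: Mc vec_eq_iff vector_matrix_mult_def sum.distrib sum_distrib_left algebra_simps)
  have "F_mat Q \<beta> M (u *\<^sub>R \<gamma> + v *\<^sub>R \<gamma>', u *\<^sub>R l + v *\<^sub>R l', u *\<^sub>R X + v *\<^sub>R X', u *\<^sub>R x + v *\<^sub>R x')
     = u *\<^sub>R F_mat Q \<beta> M (\<gamma>, l, X, x) + v *\<^sub>R F_mat Q \<beta> M (\<gamma>', l', X', x')"
    unfolding F_mat_eq[OF X(1)] F_mat_eq[OF X'(1)] F_mat_eq[OF sym] mc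
    by (auto simp: vec_eq_iff block_mat_def cross_mat_def sum.distrib sum_distrib_left algebra_simps
        split: option.split)
  moreover have "psd (u *\<^sub>R X + v *\<^sub>R X' - V (u *\<^sub>R x + v *\<^sub>R x'))"
  proof -
    have "v = 1 - u" "u \<in> {0..1}" using uv by auto
    then have "psd (u *\<^sub>R V x + v *\<^sub>R V x' - V (u *\<^sub>R x + v *\<^sub>R x'))"
      using V by (simp add: matrix_convex_def loewner_le_def)
    from psd_add[OF psd_convex_comb[OF uv(1,2) X(4) X'(4)] this]
    show ?thesis by (simp add: algebra_simps)
  qed
  ultimately show "u *\<^sub>R p + v *\<^sub>R q \<in> feasible_set Q \<beta> M V"
    using uv X X' sym by (simp add: p q feasible_set_def loewner_le_def psd_convex_comb)
qed

theorem theorem1: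
  fixes Q :: "'s::finite \<Rightarrow> real^'n^'n"
    and M :: "real^'p \<Rightarrow> real^('n option)^'w"
    and V :: "real^'p \<Rightarrow> real^('n option)^('n option)"
    and \<beta> :: "real^'w"
  assumes Q_psd: "\<And>i. psd (Q i)"
    and Q_sum: "posdef (\<Sum>i\<in>UNIV. Q i)"
    and M_affine: "affine_map M"
    and V_sym: "\<And>x. V x \<in> sym_mats"
    and V_convex: "matrix_convex V"
  shows "(\<forall>\<gamma> x. (\<exists>l X. (\<gamma>, l, X, x) \<in> feasible_set Q \<beta> M V) \<longrightarrow>
            (\<forall>z\<in>disturbance_set Q. \<gamma> \<ge> robust_obj \<beta> M V x z))
       \<and> convex (feasible_set Q \<beta> M V)
       \<and> (\<forall>\<gamma> x. \<not> (\<exists>l X. (\<gamma>, l, X, x) \<in> feasible_set Q \<beta> M V) \<longrightarrow>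
            (\<forall>\<epsilon>>0. \<exists>z\<in>disturbance_set Q.
               \<not> robust_obj \<beta> M V x z \<le> gamma_minus CARD('s) \<epsilon> \<gamma> (psi \<beta> M (V x) x)))"
proof (intro conjI allI impI)
  fix \<gamma> x
  assume "\<exists>l X. (\<gamma>, l, X, x) \<in> feasible_set Q \<beta> M V"
  then show "\<forall>z\<in>disturbance_set Q. \<gamma> \<ge> robust_obj \<beta> M V x z"
    by (elim exE) (intro ballI feasible_imp_robust)
next
  show "convex (feasible_set Q \<beta> M V)"
    using M_affine V_convex by (rule convex_feasible_set)
next
  fix \<gamma> x and \<epsilon> :: real
  assume infeasible: "\<not> (\<exists>l X. (\<gamma>, l, X, x) \<in> feasible_set Q \<beta> M V)" and \<epsilon>: "\<epsilon> > 0"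
  let ?R = "V x + cross_mat (\<beta> v* M x)"
  \<comment> \<open>Infeasibility for all \<open>X\<close> is used at \<open>X = V x\<close>, the
    least matrix allowed by the last constraint.\<close>
  have "\<nexists>l :: real^'s. (\<forall>i. 0 \<le> l $ i) \<and>
      psd (block_mat (\<gamma> - (\<Sum>i\<in>UNIV. l $ i)) 0 0 (\<Sum>i\<in>UNIV. l $ i *\<^sub>R Q i) - ?R)"
  proof
    assume "\<exists>l :: real^'s. (\<forall>i. 0 \<le> l $ i) \<and>
      psd (block_mat (\<gamma> - (\<Sum>i\<in>UNIV. l $ i)) 0 0 (\<Sum>i\<in>UNIV. l $ i *\<^sub>R Q i) - ?R)"
    then obtain l :: "real^'s" where "\<And>i. 0 \<le> l $ i"
      "psd (block_mat (\<gamma> - (\<Sum>i\<in>UNIV. l $ i)) 0 0 (\<Sum>i\<in>UNIV. l $ i *\<^sub>R Q i) - ?R)" by blast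
    then have "(\<gamma>, l, V x, x) \<in> feasible_set Q \<beta> M V"
      using V_sym[of x] by (simp add: feasible_set_def F_mat_eq loewner_le_def psd_zero)
    with infeasible show False by blast
  qed
  from approximate_S_lemma[OF Q_psd Q_sum sym_mats_add[OF V_sym cross_mat_sym] this \<epsilon>]
  show "\<exists>z\<in>disturbance_set Q.
      \<not> robust_obj \<beta> M V x z \<le> gamma_minus CARD('s) \<epsilon> \<gamma> (psi \<beta> M (V x) x)"
    by (simp add: robust_obj_eq psi_eq not_le)
qed

end
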